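(* Let $\mathcal X,\mathcal Y,\mathcal Z$ be finite sets and $f:\mathcal X\times\mathcal Y\to\mathcal Z$ with $\mathrm{IC}^{\mathrm{ext}}(f,0)>0$. Then there exists $\epsilon_0>0$ depending only on $f$ such that for all $0<\epsilon\le\epsilon_0$, \[ \frac{\epsilon\,\mathrm{IC}^{\mathrm{ext}}(f,0)}{2}\le \mathrm{IC}^{\mathrm{ext}}(f,0)-\mathrm{IC}^{\mathrm{ext}}(f,\epsilon)\le 4|\mathcal X||\mathcal Y|\,h(\sqrt{\epsilon}). \] Furthermore, there exist constants $\epsilon_1>0$ and $c_f>0$ depending only on $f$ such that for all $0<\epsilon\le\epsilon_1$, \[ c_f\,h(\epsilon)\le \mathrm{IC}^{\mathrm{ext}}_p(f,0)-\mathrm{IC}^{\mathrm{ext}}_p(f,\epsilon)\le 4|\mathcal X||\mathcal Y|\,h(\sqrt{\epsilon}). \]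
   Context: $h(p)=-p\log p-(1-p)\log(1-p)$ is the binary entropy function (logs base 2, $0\log0=0$). Two-party communication model: Alice gets $x\in\mathcal X$, Bob gets $y\in\mathcal Y$; protocols may use public and private randomness; the transcript $\Pi$ consists of the public random string and all transmitted bits; the output $\pi(x,y)$ is determined by the transcript. For a distribution $\mu$ on $\mathcal X\times\mathcal Y$ with $(X,Y)\sim\mu$, $\mathrm{IC}^{\mathrm{ext}}_\mu(\pi)=I(\Pi;XY)$. A protocol performs $[f,\eta]$ if $\Pr[\pi(x,y)\ne f(x,y)]\le\eta$ for every $(x,y)$. $\mathrm{IC}^{\mathrm{ext}}_\mu(f,\eta)=\inf\{\mathrm{IC}^{\mathrm{ext}}_\mu(\pi):\pi\text{ performs }[f,\eta]\}$; $\mathrm{IC}^{\mathrm{ext}}(f,\eta)=\sup_\mu\mathrm{IC}^{\mathrm{ext}}_\mu(f,\eta)$ over all distributions $\mu$ on $\mathcal X\times\mathcal Y$; $\mathrm{IC}^{\mathrm{ext}}_p(f,\eta)=\sup_{\mu}\mathrm{IC}^{\mathrm{ext}}_\mu(f,\eta)$ over all product distributions $\mu=\mu_1\times\mu_2$ on $\mathcal X\times\mathcal Y$. *)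

theory Defs
  imports "HOL-Probability.Probability_Mass_Function"
begin

definition xlog2 :: "real \<Rightarrow> real" where
  "xlog2 p = (if p = 0 then 0 else p * log 2 p)"

definition bin_entropy :: "real \<Rightarrow> real" where
  "bin_entropy p = - xlog2 p - xlog2 (1 - p)"

definition mutual_info :: "('a \<times> 'b) pmf \<Rightarrow> real" where
  "mutual_info J = (\<Sum>ab\<in>set_pmf J. pmf J ab *
       log 2 (pmf J ab / (pmf (map_pmf fst J) (fst ab) * pmf (map_pmf snd J) (snd ab))))"

text \<open>A two-party protocol (finite depth). Public random string r, Alice's private
  randomness a, Bob's private randomness b (all natural-number valued).
  speaker r h: None = protocol has halted, Some True = Alice speaks, Some False = Bob speaks.
  Alice's bit depends on x, r, a and the history; Bob's on y, r, b and the history.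
  The output is a function of the transcript (r, transmitted bits).\<close>
record ('x, 'y, 'z) protocol =
  pub :: "nat pmf"
  privA :: "nat pmf"
  privB :: "nat pmf"
  depth :: nat
  speaker :: "nat \<Rightarrow> bool list \<Rightarrow> bool option"
  msgA :: "'x \<Rightarrow> nat \<Rightarrow> nat \<Rightarrow> bool list \<Rightarrow> bool"
  msgB :: "'y \<Rightarrow> nat \<Rightarrow> nat \<Rightarrow> bool list \<Rightarrow> bool"
  out :: "nat \<Rightarrow> bool list \<Rightarrow> 'z"

primrec run :: "('x, 'y, 'z) protocol \<Rightarrow> 'x \<Rightarrow> 'y \<Rightarrow> nat \<Rightarrow> nat \<Rightarrow> nat \<Rightarrow> nat
                 \<Rightarrow> bool list \<Rightarrow> bool list" where
  "run P x y r a b 0 h = h"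
| "run P x y r a b (Suc n) h =
     (case speaker P r h of
        None \<Rightarrow> h
      | Some True \<Rightarrow> run P x y r a b n (h @ [msgA P x r a h])
      | Some False \<Rightarrow> run P x y r a b n (h @ [msgB P y r b h]))"

definition finite_protocol :: "('x, 'y, 'z) protocol \<Rightarrow> bool" where
  "finite_protocol P \<longleftrightarrow> finite (set_pmf (pub P)) \<and> finite (set_pmf (privA P))
                        \<and> finite (set_pmf (privB P))"

definition transcript :: "('x, 'y, 'z) protocol \<Rightarrow> 'x \<Rightarrow> 'y \<Rightarrow> (nat \<times> bool list) pmf" where
  "transcript P x y = map_pmf (\<lambda>(r, a, b). (r, run P x y r a b (depth P) []))
                         (pair_pmf (pub P) (pair_pmf (privA P) (privB P)))"

definition performs :: "('x, 'y, 'z) protocol \<Rightarrow> ('x \<Rightarrow> 'y \<Rightarrow> 'z) \<Rightarrow> real \<Rightarrow> bool" where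
  "performs P f \<eta> \<longleftrightarrow> (\<forall>x y. measure_pmf.prob (transcript P x y)
                        {t. out P (fst t) (snd t) \<noteq> f x y} \<le> \<eta>)"

definition IC_ext_protocol :: "('x \<times> 'y) pmf \<Rightarrow> ('x, 'y, 'z) protocol \<Rightarrow> real" where
  "IC_ext_protocol \<mu> P =
     mutual_info (bind_pmf \<mu> (\<lambda>xy. map_pmf (\<lambda>t. (t, xy)) (transcript P (fst xy) (snd xy))))"

definition IC_ext_mu :: "('x \<times> 'y) pmf \<Rightarrow> ('x \<Rightarrow> 'y \<Rightarrow> 'z) \<Rightarrow> real \<Rightarrow> real" where
  "IC_ext_mu \<mu> f \<eta> = Inf {IC_ext_protocol \<mu> P | P :: ('x, 'y, 'z) protocol.
                              finite_protocol P \<and> performs P f \<eta>}"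

definition IC_ext :: "('x \<Rightarrow> 'y \<Rightarrow> 'z) \<Rightarrow> real \<Rightarrow> real" where
  "IC_ext f \<eta> = (SUP \<mu>. IC_ext_mu \<mu> f \<eta>)"

definition IC_ext_p :: "('x \<Rightarrow> 'y \<Rightarrow> 'z) \<Rightarrow> real \<Rightarrow> real" where
  "IC_ext_p f \<eta> = (SUP \<mu> \<in> {pair_pmf \<mu>1 \<mu>2 | \<mu>1 \<mu>2. True}. IC_ext_mu \<mu> f \<eta>)"

end

theory Submission
  imports Defs "HOL-Probability.Product_PMF"
begin

text \<open>Lower bounds. Halting at once with public probability \<open>\<epsilon>\<close> multiplies the cost by \<open>1 - \<epsilon>\<close>.
  For a product distribution \<open>\<mu>1 \<times> \<mu>2\<close> each player instead resamples the input privately with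
  probability \<open>\<epsilon> / 2\<close>. This preserves the distribution of the inputs actually used, but since a zero-error
  transcript determines \<open>f\<close> at these, the cost drops by the entropy of \<open>f\<close> at
  the used inputs given the true ones, which is of order \<open>\<epsilon> log (1 / \<epsilon>)\<close> unless \<open>f\<close> is
  constant on the rectangle of heavy inputs; in that case the zero-error cost under \<open>\<mu>1 \<times> \<mu>2\<close> is
  itself small.

  Upper bounds. A protocol with error \<open>\<epsilon>\<close> is patched: after it ends, each player raises an alarm
  if the transcript might be wrong for the own input, and everything is revealed after an alarm. By
  the rectangle property the alarm conditions can be chosen so that an alarm has probability
  \<open>O(sqrt \<epsilon>)\<close>.\<close>

section \<open>Relative entropy and channel information\<close>

text \<open>The error bound for \<open>(x, y)\<close> speaks only about runs on
  \<open>(x, y)\<close>, but Alice's alarm at \<open>t\<close> must cover every \<open>y'\<close>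
  for which \<open>t\<close> would be wrong, while the actual \<open>y\<close> may make
  \<open>t\<close> far more likely than \<open>y'\<close> does. Each error is charged to a player
  for whom this disproportion is harmless, with threshold \<open>s\<close>; the resulting alarm
  masses are of order \<open>\<epsilon> / s\<close> and \<open>s\<close>, and
  \<open>s = sqrt \<epsilon>\<close> balances them. A public halting coin is visible in the
  transcript, so only a fraction \<epsilon> of the cost is saved. Private resampling hides whether
  the inputs were changed, and this hidden entropy is saved as well; but resampling the coordinates
  independently preserves the input law only for products. The gain must be uniform over all product
  distributions, and no maximiser is used: the heaviness threshold is chosen from \<open>f\<close>
  alone, such that distributions with a constant heavy rectangle stay below half the
  supremum.\<close>

lemma log_sum_inequality:
  fixes a b :: "'i \<Rightarrow> real"
  assumes fin: "finite I" and a: "\<And>i. i \<in> I \<Longrightarrow> 0 \<le> a i" and b: "\<And>i. i \<in> I \<Longrightarrow> 0 \<le> b i"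
    and ab: "\<And>i. i \<in> I \<Longrightarrow> b i = 0 \<Longrightarrow> a i = 0"
  shows "sum a I * log 2 (sum a I / sum b I) \<le> (\<Sum>i\<in>I. a i * log 2 (a i / b i))"
proof (cases "sum a I = 0")
  case True
  then have "\<And>i. i \<in> I \<Longrightarrow> a i = 0"
    using fin a sum_nonneg_eq_0_iff[of I a] by auto
  then show ?thesis using True by simp
next
  case False
  define A where "A = sum a I"
  define B where "B = sum b I"
  have A: "A > 0" using False a sum_nonneg[of I a] unfolding A_def by force
  have "B \<noteq> 0"
  proof
    assume "B = 0"
    then have "\<And>i. i \<in> I \<Longrightarrow> b i = 0"
      using fin b sum_nonneg_eq_0_iff[of I b] unfolding B_def by auto
    then have "A = 0" unfolding A_def using ab by (simp add: sum.neutral)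
    then show False using A by simp
  qed
  then have B: "B > 0" using b sum_nonneg[of I b] unfolding B_def by force
  \<comment> \<open>Tangent bound \<open>ln v \<le> v - 1\<close> at
    \<open>v = b i * A / (a i * B)\<close>. The correction terms cancel in the sum, because
    \<open>b i * A / B\<close> also sums to \<open>A\<close>.\<close>
  have "a i * log 2 (A / B) + (a i - b i * A / B) / ln 2 \<le> a i * log 2 (a i / b i)"
    if i: "i \<in> I" for i
  proof (cases "a i = 0")
    case True
    then show ?thesis using A B b[OF i] by simp
  next
    case False
    then have ai: "a i > 0" and bi: "b i > 0" using a[OF i] b[OF i] ab[OF i] by force+
    have "ln (b i * A / (a i * B)) \<le> b i * A / (a i * B) - 1"
      using ai bi A B by (intro ln_le_minus_one) simp
    then have "a i * ln (b i * A / (a i * B)) \<le> a i * (b i * A / (a i * B) - 1)"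
      using ai by (intro mult_left_mono) auto
    also have "\<dots> = b i * A / B - a i" using ai B by (simp add: field_simps)
    finally have "(a i - b i * A / B) \<le> a i * (ln (a i / b i) - ln (A / B))"
      using ai bi A B by (simp add: ln_div ln_mult algebra_simps)
    then have "(a i - b i * A / B) / ln 2 \<le> a i * (ln (a i / b i) - ln (A / B)) / ln 2"
      by (intro divide_right_mono) auto
    then show ?thesis by (simp add: log_def right_diff_distrib diff_divide_distrib)
  qed
  then have "(\<Sum>i\<in>I. a i * log 2 (A / B) + (a i - b i * A / B) / ln 2)
      \<le> (\<Sum>i\<in>I. a i * log 2 (a i / b i))" by (rule sum_mono)
  also have "(\<Sum>i\<in>I. a i * log 2 (A / B) + (a i - b i * A / B) / ln 2)
      = A * log 2 (A / B) + (A - B * A / B) / ln 2"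
    unfolding sum.distrib sum_distrib_right[symmetric] sum_divide_distrib[symmetric]
      sum_subtractf A_def[symmetric] B_def[symmetric] by simp
  finally show ?thesis using B unfolding A_def B_def by simp
qed

text \<open>Relative entropy in bits. Where \<open>q\<close> vanishes the summand is 0 instead of
  infinite, because \<open>log 2 0 = 0\<close>; hence the support inclusions assumed below.\<close>

definition kl :: "'a pmf \<Rightarrow> 'a pmf \<Rightarrow> real" where
  "kl p q = (\<Sum>t\<in>set_pmf p. pmf p t * log 2 (pmf p t / pmf q t))"

lemma kl_superset:
  "finite S \<Longrightarrow> set_pmf p \<subseteq> S \<Longrightarrow> kl p q = (\<Sum>t\<in>S. pmf p t * log 2 (pmf p t / pmf q t))"
  unfolding kl_def by (rule sum.mono_neutral_left) (auto simp: set_pmf_iff)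

lemma kl_nonneg:
  assumes "finite (set_pmf q)" "set_pmf p \<subseteq> set_pmf q"
  shows "kl p q \<ge> 0"
proof -
  have "sum (pmf p) (set_pmf q) * log 2 (sum (pmf p) (set_pmf q) / sum (pmf q) (set_pmf q))
      \<le> (\<Sum>t\<in>set_pmf q. pmf p t * log 2 (pmf p t / pmf q t))"
    using assms by (intro log_sum_inequality) (auto simp: set_pmf_iff)
  then show ?thesis
    using assms by (simp add: kl_superset sum_pmf_eq_1)
qed

lemma pmf_map_sum:
  assumes "finite S" "set_pmf p \<subseteq> S"
  shows "pmf (map_pmf g p) u = (\<Sum>t\<in>{t\<in>S. g t = u}. pmf p t)"
proof -
  have "pmf (map_pmf g p) u = measure (measure_pmf p) (g -` {u})" by (rule pmf_map)
  also have "\<dots> = measure (measure_pmf p) ((g -` {u}) \<inter> set_pmf p)"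
    by (simp add: measure_Int_set_pmf)
  also have "\<dots> = measure (measure_pmf p) {t\<in>S. g t = u}"
    using assms by (intro measure_prob_cong_0) (auto simp: set_pmf_iff)
  also have "\<dots> = (\<Sum>t\<in>{t\<in>S. g t = u}. pmf p t)"
    using assms by (intro measure_measure_pmf_finite) auto
  finally show ?thesis .
qed

lemma pmf_bind_sum:
  fixes L :: "'l::finite pmf"
  shows "pmf (bind_pmf L K) t = (\<Sum>l\<in>UNIV. pmf L l * pmf (K l) t)"
  unfolding pmf_bind by (subst integral_measure_pmf[of UNIV]) auto

text \<open>Data processing: the log-sum inequality on each fibre of \<open>g\<close>.\<close>

lemma kl_map_le:
  assumes fin: "finite (set_pmf q)" and sub: "set_pmf p \<subseteq> set_pmf q"
  shows "kl (map_pmf g p) (map_pmf g q) \<le> kl p q"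
proof -
  let ?S = "set_pmf q"
  have S: "finite {t\<in>?S. g t = u}" for u using fin by simp
  have "kl (map_pmf g p) (map_pmf g q)
      = (\<Sum>u\<in>g ` ?S. pmf (map_pmf g p) u * log 2 (pmf (map_pmf g p) u / pmf (map_pmf g q) u))"
    using assms by (intro kl_superset) auto
  also have "\<dots> \<le> (\<Sum>u\<in>g ` ?S. \<Sum>t\<in>{t\<in>?S. g t = u}. pmf p t * log 2 (pmf p t / pmf q t))"
    unfolding pmf_map_sum[OF fin sub] pmf_map_sum[OF fin order_refl]
    using sub by (intro sum_mono log_sum_inequality S) (auto simp: set_pmf_iff)
  also have "\<dots> = kl p q"
    using assms by (simp add: kl_superset sum.image_gen[OF fin, symmetric])
  finally show ?thesis .
qed

text \<open>Joint convexity: the log-sum inequality over \<open>l\<close> at each \<open>t\<close>,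
  where the common weight \<open>pmf L l\<close> cancels inside the logarithm.\<close>

lemma kl_bind_le:
  fixes L :: "'l::finite pmf"
  assumes fin: "\<And>l. finite (set_pmf (q l))" and sub: "\<And>l. set_pmf (p l) \<subseteq> set_pmf (q l)"
  shows "kl (bind_pmf L p) (bind_pmf L q) \<le> (\<Sum>l\<in>UNIV. pmf L l * kl (p l) (q l))"
proof -
  let ?S = "\<Union>l. set_pmf (q l)"
  have S: "finite ?S" using fin by auto
  have sub': "set_pmf (p l) \<subseteq> ?S" for l using sub by blast
  have ac: "pmf (p l) t = 0" if "pmf (q l) t = 0" for l t
    using sub[of l] that by (auto simp: set_pmf_iff)
  have "kl (bind_pmf L p) (bind_pmf L q)
      = (\<Sum>t\<in>?S. pmf (bind_pmf L p) t * log 2 (pmf (bind_pmf L p) t / pmf (bind_pmf L q) t))"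
    using S sub' by (intro kl_superset) auto
  also have "\<dots> \<le> (\<Sum>t\<in>?S. \<Sum>l\<in>UNIV. (pmf L l * pmf (p l) t) *
      log 2 ((pmf L l * pmf (p l) t) / (pmf L l * pmf (q l) t)))"
    unfolding pmf_bind_sum
    by (intro sum_mono log_sum_inequality) (auto simp: ac)
  also have "\<dots> = (\<Sum>t\<in>?S. \<Sum>l\<in>UNIV. pmf L l * (pmf (p l) t * log 2 (pmf (p l) t / pmf (q l) t)))"
    by (intro sum.cong refl) auto
  also have "\<dots> = (\<Sum>l\<in>UNIV. pmf L l * kl (p l) (q l))"
    by (subst sum.swap) (simp add: kl_superset[OF S sub'] sum_distrib_left)
  finally show ?thesis .
qed

text \<open>If every \<open>K b\<close> determines \<open>F b\<close>, mixing loses the entropy of \<open>F\<close>; only one summand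
  \<open>z0\<close> of that entropy is kept.\<close>

lemma kl_mixture_gain:
  fixes W :: "'b::finite pmf"
  assumes fin: "finite (set_pmf Q)"
    and sub: "\<And>b. b \<in> set_pmf W \<Longrightarrow> set_pmf (K b) \<subseteq> set_pmf Q"
    and out: "\<And>b t. t \<in> set_pmf (K b) \<Longrightarrow> Z t = F b"
    and q: "q = pmf (map_pmf F W) z0"
  shows "kl (bind_pmf W K) Q + q * log 2 (1 / q) \<le> (\<Sum>b\<in>UNIV. pmf W b * kl (K b) Q)"
proof -
  let ?S = "set_pmf Q"
  let ?M = "bind_pmf W K"
  define w where "w z = pmf (map_pmf F W) z" for z
  have M: "set_pmf ?M \<subseteq> ?S" using sub by auto
  have w: "w z = (\<Sum>b\<in>{b. F b = z}. pmf W b)" for z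
    unfolding w_def using pmf_map_sum[of UNIV W F z] by simp
  have w01: "0 \<le> w z" "w z \<le> 1" for z unfolding w_def by (auto simp: pmf_le_1)
  have step: "pmf ?M t * log 2 (pmf ?M t / pmf Q t) + pmf ?M t * log 2 (1 / w (Z t))
      \<le> (\<Sum>b\<in>UNIV. pmf W b * (pmf (K b) t * log 2 (pmf (K b) t / pmf Q t)))" if t: "t \<in> ?S" for t
  proof -
    let ?I = "{b. F b = Z t}"
    have z: "pmf (K b) t = 0" if "b \<notin> ?I" for b
      using out[of t b] that by (auto simp: set_pmf_iff)
    have Mt: "pmf ?M t = (\<Sum>b\<in>?I. pmf W b * pmf (K b) t)"
      unfolding pmf_bind_sum using z by (intro sum.mono_neutral_right) auto
    have B: "(\<Sum>b\<in>?I. pmf W b * pmf Q t) = w (Z t) * pmf Q t"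
      unfolding w by (simp add: sum_distrib_right)
    have Qt: "pmf Q t > 0" using t by (simp add: pmf_positive)
    \<comment> \<open>Only \<open>b\<close> with \<open>F b = Z t\<close> can produce
      \<open>t\<close>, so the log-sum inequality runs over that fibre alone. The reference mass
      shrinks to \<open>w (Z t) * pmf Q t\<close>, and the factor \<open>w (Z t)\<close> is the
      source of the gain.\<close>
    have "pmf ?M t * log 2 (pmf ?M t / (w (Z t) * pmf Q t))
        \<le> (\<Sum>b\<in>?I. (pmf W b * pmf (K b) t) * log 2 ((pmf W b * pmf (K b) t) / (pmf W b * pmf Q t)))"
      unfolding Mt B[symmetric] using Qt
      by (intro log_sum_inequality) auto
    also have "\<dots> = (\<Sum>b\<in>?I. pmf W b * (pmf (K b) t * log 2 (pmf (K b) t / pmf Q t)))"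
      by (intro sum.cong refl) auto
    also have "\<dots> = (\<Sum>b\<in>UNIV. pmf W b * (pmf (K b) t * log 2 (pmf (K b) t / pmf Q t)))"
      using z by (intro sum.mono_neutral_left) auto
    finally have *: "pmf ?M t * log 2 (pmf ?M t / (w (Z t) * pmf Q t)) \<le> \<dots>" .
    show ?thesis
    proof (cases "pmf ?M t = 0")
      case True
      then show ?thesis using * by simp
    next
      case False
      then have M0: "pmf ?M t > 0" by (simp add: order_less_le)
      have "w (Z t) \<noteq> 0"
      proof
        assume "w (Z t) = 0"
        then have "\<And>b. b \<in> ?I \<Longrightarrow> pmf W b = 0" unfolding w by (subst (asm) sum_nonneg_eq_0_iff) auto
        then show False using M0 unfolding Mt by simp
      qed
      then have "w (Z t) > 0" using w01 by (simp add: order_less_le)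
      then have "log 2 (pmf ?M t / (w (Z t) * pmf Q t)) = log 2 (pmf ?M t / pmf Q t) + log 2 (1 / w (Z t))"
        using M0 Qt by (simp add: log_divide log_mult)
      then show ?thesis using * by (simp add: distrib_left)
    qed
  qed
  have mapM: "map_pmf Z ?M = map_pmf F W"
  proof -
    have "map_pmf Z (K b) = return_pmf (F b)" for b
      using out[of _ b] map_pmf_cong[OF refl, of "K b" Z "\<lambda>_. F b"] by simp
    then show ?thesis by (simp add: map_bind_pmf) (simp add: map_pmf_def)
  qed
  have "q * log 2 (1 / q) = (\<Sum>t\<in>{t\<in>?S. Z t = z0}. pmf ?M t * log 2 (1 / w (Z t)))"
    unfolding q mapM[symmetric] pmf_map_sum[OF fin M] sum_distrib_right
    by (intro sum.cong refl) (auto simp: w_def mapM[symmetric] pmf_map_sum[OF fin M])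
  also have "\<dots> \<le> (\<Sum>t\<in>?S. pmf ?M t * log 2 (1 / w (Z t)))"
  proof (intro sum_mono2 fin)
    fix t
    have "log 2 (1 / w (Z t)) \<ge> 0"
    proof (cases "w (Z t) = 0")
      case False
      then have "0 < w (Z t)" using w01 by (simp add: order_less_le)
      then show ?thesis using w01 by simp
    qed (simp add: log_def)
    then show "0 \<le> pmf ?M t * log 2 (1 / w (Z t))" by simp
  qed auto
  finally have "kl ?M Q + q * log 2 (1 / q)
      \<le> (\<Sum>t\<in>?S. pmf ?M t * log 2 (pmf ?M t / pmf Q t) + pmf ?M t * log 2 (1 / w (Z t)))"
    using kl_superset[OF fin M, of Q] by (simp add: sum.distrib)
  also have "\<dots> \<le> (\<Sum>t\<in>?S. \<Sum>b\<in>UNIV. pmf W b * (pmf (K b) t * log 2 (pmf (K b) t / pmf Q t)))"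
    by (intro sum_mono step)
  also have "\<dots> = (\<Sum>b\<in>UNIV. pmf W b * (\<Sum>t\<in>?S. pmf (K b) t * log 2 (pmf (K b) t / pmf Q t)))"
    by (subst sum.swap) (simp add: sum_distrib_left)
  also have "\<dots> = (\<Sum>b\<in>UNIV. pmf W b * kl (K b) Q)"
  proof (rule sum.cong[OF refl])
    fix b
    show "pmf W b * (\<Sum>t\<in>?S. pmf (K b) t * log 2 (pmf (K b) t / pmf Q t)) = pmf W b * kl (K b) Q"
      using kl_superset[OF fin sub, of b Q] by (cases "b \<in> set_pmf W") (auto simp: set_pmf_iff)
  qed
  finally show ?thesis .
qed

section \<open>Information between the input and the output of a channel\<close>

definition channel_info :: "'a pmf \<Rightarrow> ('a \<Rightarrow> 't pmf) \<Rightarrow> real" where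
  "channel_info \<mu> K = mutual_info (bind_pmf \<mu> (\<lambda>a. map_pmf (\<lambda>t. (t, a)) (K a)))"

text \<open>The joint mass at \<open>(t, a)\<close> is \<open>pmf \<mu> a * pmf (K a) t\<close>, so
  the input law cancels inside the logarithm and an average divergence from the output law
  remains.\<close>

lemma channel_info_eq:
  fixes \<mu> :: "'a::finite pmf"
  assumes fin: "\<And>a. finite (set_pmf (K a))"
  shows "channel_info \<mu> K = (\<Sum>a\<in>UNIV. pmf \<mu> a * kl (K a) (bind_pmf \<mu> K))"
proof -
  let ?J = "bind_pmf \<mu> (\<lambda>a. map_pmf (\<lambda>t. (t, a)) (K a))"
  let ?S = "\<Union>a. set_pmf (K a)"
  have S: "finite ?S" using fin by auto
  have sub: "set_pmf (K a) \<subseteq> ?S" for a by blast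
  have J: "pmf ?J (t, a) = pmf \<mu> a * pmf (K a) t" for t a
  proof -
    have "pmf (map_pmf (\<lambda>t. (t, a')) (K a')) (t, a) = (if a' = a then pmf (K a) t else 0)" for a'
    proof (cases "a' = a")
      case True
      have "pmf (map_pmf (\<lambda>t. (t, a)) (K a)) ((\<lambda>t. (t, a)) t) = pmf (K a) t"
        by (rule pmf_map_inj') (auto simp: inj_def)
      then show ?thesis using True by simp
    qed (auto simp: pmf_eq_0_set_pmf)
    then have "pmf ?J (t, a) = (\<Sum>a'\<in>UNIV. pmf \<mu> a' * (if a' = a then pmf (K a) t else 0))"
      unfolding pmf_bind_sum by (intro sum.cong refl) simp
    then show ?thesis by (simp add: if_distrib cong: if_cong)
  qed
  have fst: "map_pmf fst ?J = bind_pmf \<mu> K"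
    by (simp add: map_bind_pmf pmf.map_comp o_def)
  have snd: "map_pmf snd ?J = \<mu>"
    by (simp add: map_bind_pmf pmf.map_comp o_def bind_return_pmf')
  have "channel_info \<mu> K = (\<Sum>ab\<in>?S \<times> UNIV. pmf ?J ab *
       log 2 (pmf ?J ab / (pmf (bind_pmf \<mu> K) (fst ab) * pmf \<mu> (snd ab))))"
    unfolding channel_info_def mutual_info_def fst snd
  proof (rule sum.mono_neutral_left)
    show "finite (?S \<times> (UNIV :: 'a set))" using S by simp
    show "set_pmf ?J \<subseteq> ?S \<times> UNIV" by auto
  qed (simp add: set_pmf_iff del: set_bind_pmf)
  also have "\<dots> = (\<Sum>t\<in>?S. \<Sum>a\<in>UNIV. pmf \<mu> a * (pmf (K a) t * log 2 (pmf (K a) t / pmf (bind_pmf \<mu> K) t)))"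
    unfolding sum.cartesian_product
    by (intro sum.cong refl) (auto simp: J)
  also have "\<dots> = (\<Sum>a\<in>UNIV. pmf \<mu> a * kl (K a) (bind_pmf \<mu> K))"
    by (subst sum.swap) (simp add: kl_superset[OF S sub] sum_distrib_left)
  finally show ?thesis .
qed

lemma set_bind_channel: "a \<in> set_pmf \<mu> \<Longrightarrow> set_pmf (K a) \<subseteq> set_pmf (bind_pmf \<mu> K)"
  by auto

lemma finite_bind_channel:
  fixes \<mu> :: "'a::finite pmf"
  shows "(\<And>a. finite (set_pmf (K a))) \<Longrightarrow> finite (set_pmf (bind_pmf \<mu> K))"
  by auto

lemma channel_info_nonneg:
  fixes \<mu> :: "'a::finite pmf"
  assumes fin: "\<And>a. finite (set_pmf (K a))"
  shows "channel_info \<mu> K \<ge> 0"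
  unfolding channel_info_eq[OF fin]
proof (rule sum_nonneg)
  fix a
  show "0 \<le> pmf \<mu> a * kl (K a) (bind_pmf \<mu> K)"
    using kl_nonneg[OF finite_bind_channel[of K, OF fin] set_bind_channel[of a \<mu> K]]
    by (cases "a \<in> set_pmf \<mu>") (auto simp: set_pmf_iff)
qed

text \<open>The right-hand side exceeds the left by exactly \<open>kl (bind_pmf \<mu> K) Q\<close>.
  Any convenient reference law therefore gives an upper bound, without knowledge of the true output
  law.\<close>

lemma channel_info_le_kl:
  fixes \<mu> :: "'a::finite pmf"
  assumes fin: "\<And>a. finite (set_pmf (K a))" and finQ: "finite (set_pmf Q)"
    and sub: "\<And>a. a \<in> set_pmf \<mu> \<Longrightarrow> set_pmf (K a) \<subseteq> set_pmf Q"
  shows "channel_info \<mu> K \<le> (\<Sum>a\<in>UNIV. pmf \<mu> a * kl (K a) Q)"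
proof -
  let ?P = "bind_pmf \<mu> K" and ?S = "set_pmf Q"
  have PS: "set_pmf ?P \<subseteq> ?S" using sub by auto
  have "pmf \<mu> a * kl (K a) Q - pmf \<mu> a * kl (K a) ?P
      = (\<Sum>t\<in>?S. pmf \<mu> a * pmf (K a) t * log 2 (pmf ?P t / pmf Q t))" for a
  proof (cases "a \<in> set_pmf \<mu>")
    case False
    then show ?thesis by (simp add: set_pmf_iff)
  next
    case True
    have "pmf (K a) t * log 2 (pmf (K a) t / pmf Q t) - pmf (K a) t * log 2 (pmf (K a) t / pmf ?P t)
        = pmf (K a) t * log 2 (pmf ?P t / pmf Q t)" for t
    proof (cases "pmf (K a) t = 0")
      case False
      then have t: "t \<in> set_pmf (K a)" by (simp add: set_pmf_iff)
      then have "t \<in> set_pmf ?P" "t \<in> ?S" using True sub by auto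
      then have "pmf (K a) t > 0" "pmf ?P t > 0" "pmf Q t > 0"
        using t by (simp_all add: pmf_positive del: set_bind_pmf)
      then show ?thesis by (simp add: log_divide algebra_simps)
    qed simp
    then show ?thesis
      unfolding kl_superset[OF finQ sub[OF True]] right_diff_distrib[symmetric] sum_subtractf[symmetric]
        sum_distrib_left mult.assoc by (simp only:)
  qed
  then have "(\<Sum>a\<in>UNIV. pmf \<mu> a * kl (K a) Q) - channel_info \<mu> K
      = (\<Sum>a\<in>UNIV. \<Sum>t\<in>?S. pmf \<mu> a * pmf (K a) t * log 2 (pmf ?P t / pmf Q t))"
    by (simp add: channel_info_eq[OF fin] sum_subtractf[symmetric])
  also have "\<dots> = kl ?P Q"
    by (subst sum.swap) (simp add: kl_superset[OF finQ PS] pmf_bind_sum sum_distrib_right)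
  finally show ?thesis using kl_nonneg[OF finQ PS] by simp
qed

lemma channel_info_map_le:
  fixes \<mu> :: "'a::finite pmf"
  assumes fin: "\<And>a. finite (set_pmf (K a))"
  shows "channel_info \<mu> (\<lambda>a. map_pmf g (K a)) \<le> channel_info \<mu> K"
proof -
  have fin': "finite (set_pmf (map_pmf g (K a)))" for a using fin by simp
  have "pmf \<mu> a * kl (map_pmf g (K a)) (map_pmf g (bind_pmf \<mu> K)) \<le> pmf \<mu> a * kl (K a) (bind_pmf \<mu> K)" for a
  proof (cases "a \<in> set_pmf \<mu>")
    case True
    then show ?thesis
      using kl_map_le[OF finite_bind_channel[OF fin] set_bind_channel[OF True]]
      by (intro mult_left_mono) auto
  qed (simp add: set_pmf_iff)
  then show ?thesis
    unfolding channel_info_eq[OF fin] channel_info_eq[OF fin'] map_bind_pmf[symmetric]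
    by (rule sum_mono)
qed

text \<open>As \<open>W\<close> preserves \<open>\<mu>\<close>, both channels have the same output
  law, so all divergences refer to one \<open>Q\<close> and \<open>kl_mixture_gain\<close> applies
  input by input. Of these gains only the one at \<open>a0\<close> is kept.\<close>

lemma channel_info_resample:
  fixes \<mu> :: "'a::finite pmf"
  assumes fin: "\<And>a. finite (set_pmf (K a))"
    and inv: "bind_pmf \<mu> W = \<mu>"
    and out: "\<And>b t. t \<in> set_pmf (K b) \<Longrightarrow> Z t = F b"
    and q: "q = pmf (map_pmf F (W a0)) z0"
  shows "channel_info \<mu> (\<lambda>a. bind_pmf (W a) K) + pmf \<mu> a0 * (q * log 2 (1 / q)) \<le> channel_info \<mu> K"
proof -
  let ?Q = "bind_pmf \<mu> K"
  have fin': "finite (set_pmf (bind_pmf (W a) K))" for a using fin by auto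
  have Q: "bind_pmf \<mu> (\<lambda>a. bind_pmf (W a) K) = ?Q"
    using bind_assoc_pmf[of \<mu> W K] inv by simp
  have finQ: "finite (set_pmf ?Q)" by (rule finite_bind_channel[OF fin])
  define g where "g a = (if a = a0 then q * log 2 (1 / q) else 0)" for a
  have step: "pmf \<mu> a * kl (bind_pmf (W a) K) ?Q + pmf \<mu> a * g a
      \<le> pmf \<mu> a * (\<Sum>b\<in>UNIV. pmf (W a) b * kl (K b) ?Q)" for a
  proof (cases "a \<in> set_pmf \<mu>")
    case False
    then show ?thesis by (simp add: set_pmf_iff)
  next
    case True
    have sub: "set_pmf (K b) \<subseteq> set_pmf ?Q" if "b \<in> set_pmf (W a)" for b
    proof (rule set_bind_channel)
      have "b \<in> set_pmf (bind_pmf \<mu> W)" using True that by auto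
      then show "b \<in> set_pmf \<mu>" using inv by simp
    qed
    have gain: "kl (bind_pmf (W a) K) ?Q + pmf (map_pmf F (W a)) z0 * log 2 (1 / pmf (map_pmf F (W a)) z0)
       \<le> (\<Sum>b\<in>UNIV. pmf (W a) b * kl (K b) ?Q)"
      by (rule kl_mixture_gain[OF finQ sub out refl])
    moreover have "0 \<le> u * log 2 (1 / u)" if "0 \<le> u" "u \<le> 1" for u :: real
    proof (cases "u = 0")
      case False
      then have "0 \<le> log 2 (1 / u)" using that by simp
      then show ?thesis using that by simp
    qed simp
    then have "0 \<le> pmf (map_pmf F (W a)) z0 * log 2 (1 / pmf (map_pmf F (W a)) z0)"
      by (simp add: pmf_le_1)
    ultimately have "kl (bind_pmf (W a) K) ?Q + g a \<le> (\<Sum>b\<in>UNIV. pmf (W a) b * kl (K b) ?Q)"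
      unfolding g_def q by (cases "a = a0") auto
    then show ?thesis by (simp add: distrib_left[symmetric] mult_left_mono)
  qed
  have "channel_info \<mu> (\<lambda>a. bind_pmf (W a) K) + pmf \<mu> a0 * (q * log 2 (1 / q))
      = (\<Sum>a\<in>UNIV. pmf \<mu> a * kl (bind_pmf (W a) K) ?Q + pmf \<mu> a * g a)"
    unfolding channel_info_eq[OF fin'] Q sum.distrib by (simp add: g_def if_distrib cong: if_cong)
  also have "\<dots> \<le> (\<Sum>a\<in>UNIV. pmf \<mu> a * (\<Sum>b\<in>UNIV. pmf (W a) b * kl (K b) ?Q))"
    by (intro sum_mono step)
  also have "\<dots> = (\<Sum>b\<in>UNIV. (\<Sum>a\<in>UNIV. pmf \<mu> a * pmf (W a) b) * kl (K b) ?Q)"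
    unfolding sum_distrib_left sum_distrib_right by (subst sum.swap) (simp add: mult.assoc)
  also have "\<dots> = channel_info \<mu> K"
    unfolding pmf_bind_sum[symmetric] inv channel_info_eq[OF fin] ..
  finally show ?thesis .
qed

lemma channel_info_const: "channel_info \<mu> (\<lambda>_. K) = 0" if "finite (set_pmf K)" for \<mu> :: "'a::finite pmf"
proof -
  have "kl K K = 0" unfolding kl_def by (auto simp: set_pmf_iff)
  then show ?thesis using that by (simp add: channel_info_eq)
qed

text \<open>Exchanging the two draws shows that the output law is itself the
  \<open>L\<close>-mixture of the output laws of the \<open>K l\<close>; joint convexity of
  \<open>kl\<close> then applies to each input.\<close>

lemma channel_info_mix:
  fixes \<mu> :: "'a::finite pmf" and L :: "'l::finite pmf"
  assumes fin: "\<And>l a. finite (set_pmf (K l a))"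
  shows "channel_info \<mu> (\<lambda>a. bind_pmf L (\<lambda>l. K l a)) \<le> (\<Sum>l\<in>UNIV. pmf L l * channel_info \<mu> (K l))"
proof -
  have fin': "finite (set_pmf (bind_pmf L (\<lambda>l. K l a)))" for a using fin by auto
  have step: "pmf \<mu> a * kl (bind_pmf L (\<lambda>l. K l a)) (bind_pmf L (\<lambda>l. bind_pmf \<mu> (K l)))
      \<le> pmf \<mu> a * (\<Sum>l\<in>UNIV. pmf L l * kl (K l a) (bind_pmf \<mu> (K l)))" for a
  proof (cases "a \<in> set_pmf \<mu>")
    case True
    have "kl (bind_pmf L (\<lambda>l. K l a)) (bind_pmf L (\<lambda>l. bind_pmf \<mu> (K l)))
      \<le> (\<Sum>l\<in>UNIV. pmf L l * kl (K l a) (bind_pmf \<mu> (K l)))"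
      using fin True by (intro kl_bind_le) auto
    then show ?thesis by (intro mult_left_mono) auto
  qed (simp add: set_pmf_iff)
  have "channel_info \<mu> (\<lambda>a. bind_pmf L (\<lambda>l. K l a))
      = (\<Sum>a\<in>UNIV. pmf \<mu> a * kl (bind_pmf L (\<lambda>l. K l a)) (bind_pmf L (\<lambda>l. bind_pmf \<mu> (K l))))"
    unfolding channel_info_eq[OF fin'] by (subst bind_commute_pmf) simp
  also have "\<dots> \<le> (\<Sum>a\<in>UNIV. pmf \<mu> a * (\<Sum>l\<in>UNIV. pmf L l * kl (K l a) (bind_pmf \<mu> (K l))))"
    by (intro sum_mono step)
  also have "\<dots> = (\<Sum>l\<in>UNIV. pmf L l * channel_info \<mu> (K l))"
    unfolding channel_info_eq[OF fin] sum_distrib_left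
    by (subst sum.swap) (simp add: mult.left_commute)
  finally show ?thesis .
qed

section \<open>Protocols as trees\<close>

lemma IC_ext_protocol_eq:
  "IC_ext_protocol \<mu> P = channel_info \<mu> (\<lambda>xy. transcript P (fst xy) (snd xy))"
  unfolding IC_ext_protocol_def channel_info_def ..

lemma finite_transcript: "finite_protocol P \<Longrightarrow> finite (set_pmf (transcript P x y))"
  unfolding finite_protocol_def transcript_def by simp

text \<open>A protocol with fixed public string. In this form, appending a phase that depends on the
  outcome is substitution at the leaves (\<open>graft\<close>). The \<open>nat\<close> argument of a
  query is the speaker's private randomness.\<close>

datatype ('x, 'y, 'o) ptree =
    Leaf 'o
  | ANode "'x \<Rightarrow> nat \<Rightarrow> bool" "('x, 'y, 'o) ptree" "('x, 'y, 'o) ptree"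
  | BNode "'y \<Rightarrow> nat \<Rightarrow> bool" "('x, 'y, 'o) ptree" "('x, 'y, 'o) ptree"

primrec tree_path :: "('x, 'y, 'o) ptree \<Rightarrow> 'x \<Rightarrow> 'y \<Rightarrow> nat \<Rightarrow> nat \<Rightarrow> bool list" where
  "tree_path (Leaf l) x y a b = []"
| "tree_path (ANode q s t) x y a b = (if q x a then True # tree_path s x y a b else False # tree_path t x y a b)"
| "tree_path (BNode q s t) x y a b = (if q y b then True # tree_path s x y a b else False # tree_path t x y a b)"

primrec leaf :: "('x, 'y, 'o) ptree \<Rightarrow> 'x \<Rightarrow> 'y \<Rightarrow> nat \<Rightarrow> nat \<Rightarrow> 'o" where
  "leaf (Leaf l) x y a b = l"
| "leaf (ANode q s t) x y a b = (if q x a then leaf s x y a b else leaf t x y a b)"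
| "leaf (BNode q s t) x y a b = (if q y b then leaf s x y a b else leaf t x y a b)"

primrec height :: "('x, 'y, 'o) ptree \<Rightarrow> nat" where
  "height (Leaf l) = 0"
| "height (ANode q s t) = Suc (max (height s) (height t))"
| "height (BNode q s t) = Suc (max (height s) (height t))"

primrec graft :: "('x, 'y, 'o) ptree \<Rightarrow> ('o \<Rightarrow> ('x, 'y, 'p) ptree) \<Rightarrow> ('x, 'y, 'p) ptree" where
  "graft (Leaf l) k = k l"
| "graft (ANode q s t) k = ANode q (graft s k) (graft t k)"
| "graft (BNode q s t) k = BNode q (graft s k) (graft t k)"

lemma path_graft: "tree_path (graft T k) x y a b = tree_path T x y a b @ tree_path (k (leaf T x y a b)) x y a b"
  by (induction T) auto

lemma leaf_graft: "leaf (graft T k) x y a b = leaf (k (leaf T x y a b)) x y a b"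
  by (induction T) auto

lemma height_graft: "(\<And>l. height (k l) \<le> m) \<Longrightarrow> height (graft T k) \<le> height T + m"
  by (induction T) auto

text \<open>Leaves are their own children, which keeps \<open>descend\<close> total on histories
  that run past the end.\<close>

primrec child :: "('x, 'y, 'o) ptree \<Rightarrow> bool \<Rightarrow> ('x, 'y, 'o) ptree" where
  "child (Leaf l) c = Leaf l"
| "child (ANode q s t) c = (if c then s else t)"
| "child (BNode q s t) c = (if c then s else t)"

primrec descend :: "('x, 'y, 'o) ptree \<Rightarrow> bool list \<Rightarrow> ('x, 'y, 'o) ptree" where
  "descend T [] = T"
| "descend T (c # h) = descend (child T c) h"

lemma descend_append: "descend T (h @ h') = descend (descend T h) h'"
  by (induction h arbitrary: T) auto

lemma descend_path: "descend T (tree_path T x y a b) = Leaf (leaf T x y a b)"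
  by (induction T) auto

definition tree_protocol :: "nat pmf \<Rightarrow> nat pmf \<Rightarrow> nat pmf \<Rightarrow> nat
    \<Rightarrow> (nat \<Rightarrow> ('x, 'y, 'z) ptree) \<Rightarrow> ('x, 'y, 'z) protocol" where
  "tree_protocol R A B d T = \<lparr>pub = R, privA = A, privB = B, depth = d,
     speaker = (\<lambda>r h. case descend (T r) h of Leaf _ \<Rightarrow> None
        | ANode _ _ _ \<Rightarrow> Some True | BNode _ _ _ \<Rightarrow> Some False),
     msgA = (\<lambda>x r a h. case descend (T r) h of ANode q _ _ \<Rightarrow> q x a | _ \<Rightarrow> False),
     msgB = (\<lambda>y r b h. case descend (T r) h of BNode q _ _ \<Rightarrow> q y b | _ \<Rightarrow> False),
     out = (\<lambda>r h. case descend (T r) h of Leaf l \<Rightarrow> l | _ \<Rightarrow> undefined)\<rparr>"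

lemma run_tree_protocol:
  assumes "height (descend (T r) h) \<le> n"
  shows "run (tree_protocol R A B d T) x y r a b n h = h @ tree_path (descend (T r) h) x y a b"
  using assms
proof (induction n arbitrary: h)
  case 0
  then show ?case by (cases "descend (T r) h") auto
next
  case (Suc n)
  show ?case
  proof (cases "descend (T r) h")
    case (Leaf l)
    then show ?thesis by (simp add: tree_protocol_def)
  next
    case (ANode q s t)
    then have "descend (T r) (h @ [c]) = (if c then s else t)" for c by (simp add: descend_append)
    with Suc.prems Suc.IH[of "h @ [q x a]"] ANode show ?thesis
      by (auto simp: tree_protocol_def)
  next
    case (BNode q s t)
    then have "descend (T r) (h @ [c]) = (if c then s else t)" for c by (simp add: descend_append)
    with Suc.prems Suc.IH[of "h @ [q y b]"] BNode show ?thesis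
      by (auto simp: tree_protocol_def)
  qed
qed

text \<open>The leaves store the complete history, so that a grafted phase can depend on it.\<close>

primrec unfold_tree :: "('x, 'y, 'z) protocol \<Rightarrow> nat \<Rightarrow> nat \<Rightarrow> bool list
    \<Rightarrow> ('x, 'y, bool list) ptree" where
  "unfold_tree P r 0 h = Leaf h"
| "unfold_tree P r (Suc n) h = (case speaker P r h of None \<Rightarrow> Leaf h
     | Some True \<Rightarrow> ANode (\<lambda>x a. msgA P x r a h)
         (unfold_tree P r n (h @ [True])) (unfold_tree P r n (h @ [False]))
     | Some False \<Rightarrow> BNode (\<lambda>y b. msgB P y r b h)
         (unfold_tree P r n (h @ [True])) (unfold_tree P r n (h @ [False])))"

lemma run_eq_leaf: "run P x y r a b n h = leaf (unfold_tree P r n h) x y a b"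
proof (induction n arbitrary: h)
  case (Suc n)
  have "c = True \<or> c = False" for c by blast
  with Suc show ?case
    by (cases "msgA P x r a h"; cases "msgB P y r b h") (auto split: option.split bool.split)
qed simp

lemma run_eq_path: "run P x y r a b n h = h @ tree_path (unfold_tree P r n h) x y a b"
proof (induction n arbitrary: h)
  case (Suc n)
  then show ?case
    by (cases "msgA P x r a h"; cases "msgB P y r b h") (auto split: option.split bool.split)
qed simp

lemma height_unfold_tree: "height (unfold_tree P r n h) \<le> n"
  by (induction n arbitrary: h) (auto split: option.split bool.split)

section \<open>Rectangle structure of transcripts\<close>

primrec fitA :: "('x, 'y, 'o) ptree \<Rightarrow> 'x \<Rightarrow> nat \<Rightarrow> bool list \<Rightarrow> bool" where
  "fitA (Leaf l) x a p = (p = [])"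
| "fitA (ANode q s t) x a p = (case p of [] \<Rightarrow> False
     | c # p' \<Rightarrow> c = q x a \<and> (if c then fitA s x a p' else fitA t x a p'))"
| "fitA (BNode q s t) x a p = (case p of [] \<Rightarrow> False
     | c # p' \<Rightarrow> if c then fitA s x a p' else fitA t x a p')"

primrec fitB :: "('x, 'y, 'o) ptree \<Rightarrow> 'y \<Rightarrow> nat \<Rightarrow> bool list \<Rightarrow> bool" where
  "fitB (Leaf l) y b p = (p = [])"
| "fitB (ANode q s t) y b p = (case p of [] \<Rightarrow> False
     | c # p' \<Rightarrow> if c then fitB s y b p' else fitB t y b p')"
| "fitB (BNode q s t) y b p = (case p of [] \<Rightarrow> False
     | c # p' \<Rightarrow> c = q y b \<and> (if c then fitB s y b p' else fitB t y b p'))"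

text \<open>\<open>fitA\<close> tests only Alice's bits of \<open>p\<close> and lets Bob's pass,
  \<open>fitB\<close> the reverse. Hence the event splits into a condition on \<open>(x, a)\<close>
  and one on \<open>(y, b)\<close>.\<close>

lemma path_eq_iff: "tree_path T x y a b = p \<longleftrightarrow> fitA T x a p \<and> fitB T y b p"
  by (induction T arbitrary: p) (auto split: list.split)

text \<open>Given the public string, producing \<open>t\<close> is a product event in the two
  independent private random numbers. The public probability is absorbed into Alice's
  factor.\<close>

lemma transcript_rectangle:
  obtains A B where
    "\<And>x y t. pmf (transcript P x y) t = A x t * B y t"
    "\<And>x t. 0 \<le> A x t" "\<And>y t. 0 \<le> (B y t :: real)"
proof
  let ?T = "\<lambda>r. unfold_tree P r (depth P) []"
  define SA where "SA x t = {a. fitA (?T (fst t)) x a (snd t)}" for x t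
  define SB where "SB y t = {b. fitB (?T (fst t)) y b (snd t)}" for y t
  fix x y t
  have "pmf (transcript P x y) t = measure (measure_pmf (pair_pmf (pub P) (pair_pmf (privA P) (privB P))))
      ({fst t} \<times> (SA x t \<times> SB y t))"
    unfolding transcript_def pmf_map
    by (intro arg_cong[where f = "measure _"]) (cases t, auto simp: run_eq_path path_eq_iff path_eq_iff[THEN iffD1, OF refl] SA_def SB_def)
  also have "\<dots> = pmf (pub P) (fst t) *
      (measure (measure_pmf (privA P)) (SA x t) * measure (measure_pmf (privB P)) (SB y t))"
    by (simp add: measure_pmf_prob_product pmf.rep_eq)
  finally show "pmf (transcript P x y) t = (pmf (pub P) (fst t) * measure (measure_pmf (privA P)) (SA x t))
      * measure (measure_pmf (privB P)) (SB y t)" by simp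
qed auto

section \<open>Revealing the inputs after an alarm\<close>

primrec askA :: "'x list \<Rightarrow> ('x \<Rightarrow> ('x, 'y, 'o) ptree) \<Rightarrow> ('x, 'y, 'o) ptree" where
  "askA [] k = k undefined"
| "askA (v # vs) k = ANode (\<lambda>x _. x = v) (k v) (askA vs k)"

primrec askB :: "'y list \<Rightarrow> ('y \<Rightarrow> ('x, 'y, 'o) ptree) \<Rightarrow> ('x, 'y, 'o) ptree" where
  "askB [] k = k undefined"
| "askB (v # vs) k = BNode (\<lambda>y _. y = v) (k v) (askB vs k)"

lemma leaf_askA: "x \<in> set vs \<Longrightarrow> leaf (askA vs k) x y a b = leaf (k x) x y a b"
  by (induction vs) auto

lemma leaf_askB: "y \<in> set vs \<Longrightarrow> leaf (askB vs k) x y a b = leaf (k y) x y a b"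
  by (induction vs) auto

lemma height_askA: "(\<And>v. height (k v) \<le> m) \<Longrightarrow> height (askA vs k) \<le> length vs + m"
  by (induction vs) (auto simp: le_SucI trans_le_add2)

lemma height_askB: "(\<And>v. height (k v) \<le> m) \<Longrightarrow> height (askB vs k) \<le> length vs + m"
  by (induction vs) (auto simp: le_SucI trans_le_add2)

lemma path_askA:
  "(\<And>v. tree_path (k v) x y a b = tree_path (k v) x y a' b') \<Longrightarrow> tree_path (askA vs k) x y a b = tree_path (askA vs k) x y a' b'"
  by (induction vs) auto

lemma path_askB:
  "(\<And>v. tree_path (k v) x y a b = tree_path (k v) x y a' b') \<Longrightarrow> tree_path (askB vs k) x y a b = tree_path (askB vs k) x y a' b'"
  by (induction vs) auto

text \<open>Besides correctness, the cost estimate needs the new transcript to be a function of the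
  old one and a tag that is \<open>None\<close> unless an alarm is raised. The length of the
  appended conversation is then irrelevant to the cost.\<close>

lemma patched_protocol:
  fixes f :: "'x::finite \<Rightarrow> 'y::finite \<Rightarrow> 'z" and P :: "('x, 'y, 'z) protocol"
  assumes fin: "finite_protocol P"
    and bad: "\<And>x y t. t \<in> set_pmf (transcript P x y) \<Longrightarrow> out P (fst t) (snd t) \<noteq> f x y
        \<Longrightarrow> badA t x \<or> badB t y"
  obtains P' g where "finite_protocol P'" "performs P' f 0"
    "\<And>x y. transcript P' x y
        = map_pmf (\<lambda>t. g (t, if badA t x \<or> badB t y then Some (x, y) else None)) (transcript P x y)"
proof -
  obtain xs :: "'x list" where xs: "set xs = UNIV" using finite_list[OF finite_class.finite_UNIV] by blast
  obtain ys :: "'y list" where ys: "set ys = UNIV" using finite_list[OF finite_class.finite_UNIV] by blast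
  \<comment> \<open>Inputs are announced by equality queries in list order. The default
    \<open>k undefined\<close> in \<open>askA\<close> and \<open>askB\<close> is unreachable,
    because the lists contain every element.\<close>
  define reveal :: "('x, 'y, 'z) ptree" where "reveal = askA xs (\<lambda>x. askB ys (\<lambda>y. Leaf (f x y)))"
  define post where "post t = ANode (\<lambda>x _. badA t x) reveal
      (BNode (\<lambda>y _. badB t y) reveal (Leaf (out P (fst t) (snd t))))" for t
  define T where "T r = graft (unfold_tree P r (depth P) []) (\<lambda>h. post (r, h))" for r
  define d where "d = depth P + (length xs + length ys + 2)"
  define P' where "P' = tree_protocol (pub P) (privA P) (privB P) d T"
  \<comment> \<open>\<open>[False, False]\<close> records two silent alarm bits. After an alarm the
    appended bits depend only on the old transcript and \<open>(x, y)\<close>, so 0 can stand for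
    the private randomness.\<close>
  define g where "g to = (case snd to of None \<Rightarrow> (fst (fst to), snd (fst to) @ [False, False])
     | Some xy \<Rightarrow> (fst (fst to), snd (fst to) @ tree_path (post (fst to)) (fst xy) (snd xy) 0 0))"
    for to :: "(nat \<times> bool list) \<times> ('x \<times> 'y) option"
  have "height reveal \<le> length xs + (length ys + 0)"
    unfolding reveal_def by (intro height_askA height_askB) simp
  then have hpost: "height (post t) \<le> length xs + length ys + 2" for t by (simp add: post_def)
  have hT: "height (T r) \<le> d" for r
    using height_graft[of "\<lambda>h. post (r, h)" "length xs + length ys + 2" "unfold_tree P r (depth P) []"]
      height_unfold_tree[of P r "depth P" "[]"] hpost unfolding T_def d_def by fastforce
  have run: "run P' x y r a b d [] = tree_path (T r) x y a b" for x y r a b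
    unfolding P'_def using run_tree_protocol[of T r "[]" d] hT by simp
  have path_reveal: "tree_path reveal x y a b = tree_path reveal x y 0 0" for x y a b
    unfolding reveal_def by (intro path_askA path_askB) simp
  have path_post: "tree_path (post t) x y a b
      = (if badA t x \<or> badB t y then tree_path (post t) x y 0 0 else [False, False])" for t x y a b
    unfolding post_def by (auto simp: path_reveal[of x y a b])
  have leaf_reveal: "leaf reveal x y a b = f x y" for x y a b
    by (simp add: reveal_def leaf_askA leaf_askB xs ys)
  have trans: "transcript P' x y
      = map_pmf (\<lambda>t. g (t, if badA t x \<or> badB t y then Some (x, y) else None)) (transcript P x y)" for x y
  proof -
    have "(r, run P' x y r a b d []) = g ((r, run P x y r a b (depth P) []),
        if badA (r, run P x y r a b (depth P) []) x \<or> badB (r, run P x y r a b (depth P) []) y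
        then Some (x, y) else None)" for r a b
      unfolding run T_def path_graft run_eq_leaf[symmetric]
      by (subst path_post) (auto simp: g_def run_eq_path)
    then show ?thesis
      unfolding transcript_def pmf.map_comp
      by (intro map_pmf_cong) (auto simp: P'_def tree_protocol_def o_def)
  qed
  have "performs P' f 0"
    unfolding performs_def
  proof (intro allI)
    fix x y
    have "out P' (fst t) (snd t) = f x y" if t: "t \<in> set_pmf (transcript P' x y)" for t
    proof -
      obtain r a b where rab: "r \<in> set_pmf (pub P)" "a \<in> set_pmf (privA P)" "b \<in> set_pmf (privB P)"
        and t: "t = (r, tree_path (T r) x y a b)"
        using t unfolding transcript_def by (auto simp: P'_def tree_protocol_def run[unfolded P'_def tree_protocol_def])
      let ?t = "(r, run P x y r a b (depth P) [])"
      have mem: "?t \<in> set_pmf (transcript P x y)"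
        using rab unfolding transcript_def by force
      have "out P' (fst t) (snd t) = leaf (T r) x y a b"
        by (simp add: P'_def tree_protocol_def t descend_path)
      also have "\<dots> = leaf (post ?t) x y a b"
        unfolding T_def leaf_graft run_eq_leaf[symmetric] ..
      also have "\<dots> = f x y"
        using bad[OF mem] by (auto simp: post_def leaf_reveal)
      finally show ?thesis .
    qed
    then have "set_pmf (transcript P' x y) \<inter> {t. out P' (fst t) (snd t) \<noteq> f x y} = {}" by auto
    then have "measure_pmf.prob (transcript P' x y) {t. out P' (fst t) (snd t) \<noteq> f x y} = 0"
      by (simp only: measure_pmf_zero_iff)
    then show "measure_pmf.prob (transcript P' x y) {t. out P' (fst t) (snd t) \<noteq> f x y} \<le> 0"
      by simp
  qed
  moreover have "finite_protocol P'"
    using fin by (simp add: finite_protocol_def P'_def tree_protocol_def)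
  ultimately show ?thesis using that trans by blast
qed

section \<open>Patching and mixing protocols\<close>

text \<open>The reference law for the tag is independent of the one for the transcript, so the tag
  costs exactly its expected code length under \<open>R\<close>.\<close>

lemma kl_tag:
  assumes fin: "finite (set_pmf Q)" and sub: "set_pmf p \<subseteq> set_pmf Q" and R: "\<And>t. pmf R (m t) > 0"
  shows "kl (map_pmf (\<lambda>t. (t, m t)) p) (pair_pmf Q R)
    = kl p Q + (\<Sum>t\<in>set_pmf p. pmf p t * log 2 (1 / pmf R (m t)))"
proof -
  have inj: "inj (\<lambda>t. (t, m t))" by (auto simp: inj_def)
  have pm: "pmf (map_pmf (\<lambda>t. (t, m t)) p) (t, m t) = pmf p t" for t
    using pmf_map_inj'[OF inj, of p t] by simp
  have "kl (map_pmf (\<lambda>t. (t, m t)) p) (pair_pmf Q R)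
      = (\<Sum>t\<in>set_pmf p. pmf p t * log 2 (pmf p t / (pmf Q t * pmf R (m t))))"
    unfolding kl_def set_map_pmf
    by (subst sum.reindex) (auto simp: pm pmf_pair intro: inj_on_subset[OF inj])
  also have "\<dots> = (\<Sum>t\<in>set_pmf p. pmf p t * log 2 (pmf p t / pmf Q t) + pmf p t * log 2 (1 / pmf R (m t)))"
  proof (rule sum.cong[OF refl])
    fix t assume "t \<in> set_pmf p"
    then have "pmf p t > 0" "pmf Q t > 0" using sub by (auto simp: pmf_positive)
    then show "pmf p t * log 2 (pmf p t / (pmf Q t * pmf R (m t)))
        = pmf p t * log 2 (pmf p t / pmf Q t) + pmf p t * log 2 (1 / pmf R (m t))"
      using R[of t] by (simp add: log_divide log_mult algebra_simps)
  qed
  finally show ?thesis by (simp add: sum.distrib kl_def)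
qed

text \<open>The reference law for tags gives \<open>None\<close> mass \<open>1 - p0\<close> and
  shares \<open>p0\<close> equally among the inputs. The parameter \<open>p0\<close> is separate
  from the alarm probability \<open>p\<close> because later only an upper bound on \<open>p\<close>
  is known.\<close>

lemma channel_info_tag:
  fixes \<mu> :: "'a::finite pmf" and S :: "'a \<Rightarrow> 't set"
  assumes fin: "\<And>a. finite (set_pmf (K a))" and p0: "0 < p0" "p0 < 1"
    and p: "p = (\<Sum>a\<in>UNIV. pmf \<mu> a * measure (measure_pmf (K a)) (S a))"
  shows "channel_info \<mu> (\<lambda>a. map_pmf (\<lambda>t. (t, if t \<in> S a then Some a else None)) (K a))
    \<le> channel_info \<mu> K + ((1 - p) * log 2 (1 / (1 - p0)) + p * log 2 (real CARD('a) / p0))"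
proof -
  define R :: "'a option pmf" where
    "R = bind_pmf (bernoulli_pmf p0) (\<lambda>c. if c then map_pmf Some (pmf_of_set UNIV) else return_pmf None)"
  have R_None: "pmf R None = 1 - p0"
    unfolding R_def pmf_bind_sum using p0 by (simp add: UNIV_bool pmf_eq_0_set_pmf)
  have R_Some: "pmf R (Some a) = p0 / real CARD('a)" for a
    unfolding R_def pmf_bind_sum using p0 by (simp add: UNIV_bool pmf_map_inj')
  have R_pos: "pmf R m > 0" for m
    using p0 by (cases m) (auto simp: R_None R_Some)
  define m where "m a t = (if t \<in> S a then Some a else None)" for a t
  define L1 where "L1 = log 2 (real CARD('a) / p0)"
  define L0 where "L0 = log 2 (1 / (1 - p0))"
  let ?Q = "bind_pmf \<mu> K"
  have finQ: "finite (set_pmf ?Q)" using fin by auto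
  have setR: "set_pmf R = UNIV" using R_pos by (auto simp: set_pmf_iff order_less_le)
  have tag: "(\<Sum>t\<in>set_pmf (K a). pmf (K a) t * log 2 (1 / pmf R (m a t)))
      = measure (measure_pmf (K a)) (S a) * L1 + (1 - measure (measure_pmf (K a)) (S a)) * L0" for a
  proof -
    have S: "measure (measure_pmf (K a)) (S a) = (\<Sum>t\<in>set_pmf (K a) \<inter> S a. pmf (K a) t)"
      using fin by (simp add: measure_measure_pmf_finite[symmetric] measure_Int_set_pmf Int_commute)
    have "1 = (\<Sum>t\<in>set_pmf (K a). pmf (K a) t)" using fin by (simp add: sum_pmf_eq_1)
    also have "\<dots> = (\<Sum>t\<in>set_pmf (K a) \<inter> S a. pmf (K a) t) + (\<Sum>t\<in>set_pmf (K a) - S a. pmf (K a) t)"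
      using fin by (rule sum.Int_Diff)
    finally have S': "1 - measure (measure_pmf (K a)) (S a) = (\<Sum>t\<in>set_pmf (K a) - S a. pmf (K a) t)"
      unfolding S by simp
    have "(\<Sum>t\<in>set_pmf (K a). pmf (K a) t * log 2 (1 / pmf R (m a t)))
        = (\<Sum>t\<in>set_pmf (K a) \<inter> S a. pmf (K a) t * L1) + (\<Sum>t\<in>set_pmf (K a) - S a. pmf (K a) t * L0)"
      using fin by (subst sum.Int_Diff[of _ _ "S a"]) (auto simp: m_def R_None R_Some L1_def L0_def)
    then show ?thesis unfolding S' unfolding S sum_distrib_right .
  qed
  have "channel_info \<mu> (\<lambda>a. map_pmf (\<lambda>t. (t, m a t)) (K a))
      \<le> (\<Sum>a\<in>UNIV. pmf \<mu> a * kl (map_pmf (\<lambda>t. (t, m a t)) (K a)) (pair_pmf ?Q R))"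
    using fin finQ setR by (intro channel_info_le_kl) auto
  also have "\<dots> = (\<Sum>a\<in>UNIV. pmf \<mu> a * kl (K a) ?Q + (pmf \<mu> a * measure (measure_pmf (K a)) (S a) * L1
      + (pmf \<mu> a - pmf \<mu> a * measure (measure_pmf (K a)) (S a)) * L0))"
  proof (rule sum.cong[OF refl])
    fix a
    show "pmf \<mu> a * kl (map_pmf (\<lambda>t. (t, m a t)) (K a)) (pair_pmf ?Q R) =
      pmf \<mu> a * kl (K a) ?Q + (pmf \<mu> a * measure (measure_pmf (K a)) (S a) * L1
      + (pmf \<mu> a - pmf \<mu> a * measure (measure_pmf (K a)) (S a)) * L0)"
    proof (cases "a \<in> set_pmf \<mu>")
      case True
      show ?thesis
        unfolding kl_tag[OF finQ set_bind_channel[OF True] R_pos] tag by (simp add: algebra_simps)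
    qed (simp add: set_pmf_iff)
  qed
  also have "\<dots> = channel_info \<mu> K + (p * L1 + (1 - p) * L0)"
    unfolding channel_info_eq[OF fin] sum.distrib sum_distrib_right[symmetric] sum_subtractf p
    by (simp add: sum_pmf_eq_1)
  finally show ?thesis unfolding m_def L1_def L0_def by simp
qed

section \<open>The infimum over protocols\<close>

lemma IC_ext_mu_le:
  fixes \<mu> :: "('x::finite \<times> 'y::finite) pmf" and P :: "('x, 'y, 'z) protocol"
  assumes "finite_protocol P" "performs P f \<eta>"
  shows "IC_ext_mu \<mu> f \<eta> \<le> IC_ext_protocol \<mu> P"
  unfolding IC_ext_mu_def
proof (rule cInf_lower)
  show "bdd_below {IC_ext_protocol \<mu> P |P :: ('x, 'y, 'z) protocol. finite_protocol P \<and> performs P f \<eta>}"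
    by (rule bdd_belowI[of _ 0]) (auto simp: IC_ext_protocol_eq intro!: channel_info_nonneg finite_transcript)
qed (use assms in blast)

lemma IC_ext_mu_patch:
  fixes f :: "'x::finite \<Rightarrow> 'y::finite \<Rightarrow> 'z" and P :: "('x, 'y, 'z) protocol"
  assumes fin: "finite_protocol P"
    and bad: "\<And>x y t. t \<in> set_pmf (transcript P x y) \<Longrightarrow> out P (fst t) (snd t) \<noteq> f x y
        \<Longrightarrow> badA t x \<or> badB t y"
    and p0: "0 < p0" "p0 < 1"
    and p: "p = (\<Sum>xy\<in>UNIV. pmf \<mu> xy *
      measure_pmf.prob (transcript P (fst xy) (snd xy)) {t. badA t (fst xy) \<or> badB t (snd xy)})"
  shows "IC_ext_mu \<mu> f 0 \<le> IC_ext_protocol \<mu> P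
    + ((1 - p) * log 2 (1 / (1 - p0)) + p * log 2 (real (CARD('x) * CARD('y)) / p0))"
proof -
  have "\<exists>P' g. finite_protocol P' \<and> performs P' f 0 \<and> (\<forall>x y. transcript P' x y
      = map_pmf (\<lambda>t. g (t, if badA t x \<or> badB t y then Some (x, y) else None)) (transcript P x y))"
  proof (rule patched_protocol[where f = f and badA = badA and badB = badB, OF fin bad])
    fix P' g
    assume "finite_protocol P'" "performs P' f 0" "\<And>x y. transcript P' x y
      = map_pmf (\<lambda>t. g (t, if badA t x \<or> badB t y then Some (x, y) else None)) (transcript P x y)"
    then show ?thesis by blast
  qed
  then obtain P' g where P': "finite_protocol P'" "performs P' f 0"
    and tr: "\<And>x y. transcript P' x y
        = map_pmf (\<lambda>t. g (t, if badA t x \<or> badB t y then Some (x, y) else None)) (transcript P x y)"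
    by blast
  let ?S = "\<lambda>xy. {t. badA t (fst xy) \<or> badB t (snd xy)}"
  let ?K = "\<lambda>xy. transcript P (fst xy) (snd xy)"
  have "IC_ext_mu \<mu> f 0 \<le> IC_ext_protocol \<mu> P'" by (rule IC_ext_mu_le[OF P'])
  also have "\<dots> = channel_info \<mu> (\<lambda>xy. map_pmf g (map_pmf (\<lambda>t. (t, if t \<in> ?S xy then Some xy else None)) (?K xy)))"
    unfolding IC_ext_protocol_eq tr pmf.map_comp o_def by (simp cong: if_cong)
  also have "\<dots> \<le> channel_info \<mu> (\<lambda>xy. map_pmf (\<lambda>t. (t, if t \<in> ?S xy then Some xy else None)) (?K xy))"
    using finite_transcript[OF fin] by (intro channel_info_map_le) auto
  also have "\<dots> \<le> channel_info \<mu> ?K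
      + ((1 - p) * log 2 (1 / (1 - p0)) + p * log 2 (real CARD('x \<times> 'y) / p0))"
    using finite_transcript[OF fin] p0 p by (intro channel_info_tag) auto
  finally show ?thesis unfolding IC_ext_protocol_eq by simp
qed

text \<open>Patched by alarms, this costless protocol yields the existence of zero-error protocols,
  the boundedness of the suprema, and a cheap protocol when \<open>f\<close> is constant on the
  heavy inputs.\<close>

definition const_protocol :: "'z \<Rightarrow> ('x, 'y, 'z) protocol" where
  "const_protocol z = tree_protocol (return_pmf 0) (return_pmf 0) (return_pmf 0) 0 (\<lambda>_. Leaf z)"

lemma const_protocol:
  "finite_protocol (const_protocol z)"
  "transcript (const_protocol z) x y = return_pmf (0, [])"
  "out (const_protocol z) r [] = z"
  by (simp_all add: const_protocol_def tree_protocol_def finite_protocol_def transcript_def)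

lemma IC_ext_const_protocol:
  fixes \<mu> :: "('x::finite \<times> 'y::finite) pmf"
  shows "IC_ext_protocol \<mu> (const_protocol z) = 0"
  unfolding IC_ext_protocol_eq const_protocol by (rule channel_info_const) simp

lemma ex_zero_error_protocol:
  fixes f :: "'x::finite \<Rightarrow> 'y::finite \<Rightarrow> 'z"
  shows "\<exists>P. finite_protocol P \<and> performs P f 0"
  using patched_protocol[OF const_protocol(1)[of undefined], of f "\<lambda>_ _. True"] by metis

lemma performs_mono: "performs P f \<eta> \<Longrightarrow> \<eta> \<le> \<eta>' \<Longrightarrow> performs P f \<eta>'"
  unfolding performs_def by (meson order_trans)

lemma performs_0_out:
  assumes "performs P f 0" "t \<in> set_pmf (transcript P x y)"
  shows "out P (fst t) (snd t) = f x y"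
proof -
  have "measure_pmf.prob (transcript P x y) {t. out P (fst t) (snd t) \<noteq> f x y} = 0"
    using assms(1) unfolding performs_def by (simp add: measure_le_0_iff)
  then show ?thesis using assms(2) unfolding measure_pmf_zero_iff by auto
qed

text \<open>The infimum of reals is meaningful only over a nonempty set, which is where
  \<open>ex_zero_error_protocol\<close> enters.\<close>

lemma le_IC_ext_mu:
  fixes f :: "'x::finite \<Rightarrow> 'y::finite \<Rightarrow> 'z"
  assumes "0 \<le> \<eta>"
    and "\<And>P :: ('x, 'y, 'z) protocol. finite_protocol P \<Longrightarrow> performs P f \<eta> \<Longrightarrow> c \<le> IC_ext_protocol \<mu> P"
  shows "c \<le> IC_ext_mu \<mu> f \<eta>"
  unfolding IC_ext_mu_def
proof (rule cInf_greatest)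
  show "{IC_ext_protocol \<mu> P |P :: ('x, 'y, 'z) protocol. finite_protocol P \<and> performs P f \<eta>} \<noteq> {}"
    using ex_zero_error_protocol[of f] performs_mono assms(1) by blast
qed (use assms in auto)

lemma IC_ext_mu_nonneg:
  fixes f :: "'x::finite \<Rightarrow> 'y::finite \<Rightarrow> 'z"
  shows "0 \<le> \<eta> \<Longrightarrow> 0 \<le> IC_ext_mu \<mu> f \<eta>"
  by (rule le_IC_ext_mu) (auto simp: IC_ext_protocol_eq intro!: channel_info_nonneg finite_transcript)

lemma IC_ext_mu_antimono:
  fixes f :: "'x::finite \<Rightarrow> 'y::finite \<Rightarrow> 'z"
  shows "0 \<le> \<eta> \<Longrightarrow> \<eta> \<le> \<eta>' \<Longrightarrow> IC_ext_mu \<mu> f \<eta>' \<le> IC_ext_mu \<mu> f \<eta>"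
  by (rule le_IC_ext_mu) (auto intro: IC_ext_mu_le performs_mono)

text \<open>Both inputs are always revealed: alarm probability 1, priced with
  \<open>p0 = 1/2\<close>. The point is that the bound does not depend on \<open>\<mu>\<close>, so
  the suprema are taken over bounded sets.\<close>

lemma IC_ext_mu_bounded:
  fixes f :: "'x::finite \<Rightarrow> 'y::finite \<Rightarrow> 'z"
  assumes "0 \<le> \<eta>"
  shows "IC_ext_mu \<mu> f \<eta> \<le> log 2 (2 * real (CARD('x) * CARD('y)))"
proof -
  have "IC_ext_mu \<mu> f \<eta> \<le> IC_ext_mu \<mu> f 0" by (rule IC_ext_mu_antimono) (use assms in auto)
  also have "\<dots> \<le> IC_ext_protocol \<mu> (const_protocol (undefined :: 'z)) + ((1 - 1) * log 2 (1 / (1 - 1/2))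
      + 1 * log 2 (real (CARD('x) * CARD('y)) / (1/2)))"
    by (rule IC_ext_mu_patch[where badA = "\<lambda>_ _. True" and badB = "\<lambda>_ _. True"])
      (auto simp: const_protocol sum_pmf_eq_1)
  finally show ?thesis by (simp add: IC_ext_const_protocol mult.commute)
qed

lemma prob_bind_sum:
  fixes L :: "'l::finite pmf"
  shows "measure_pmf.prob (bind_pmf L K) A = (\<Sum>l\<in>UNIV. pmf L l * measure_pmf.prob (K l) A)"
proof -
  have *: "measure_pmf.prob M A = pmf (map_pmf (\<lambda>t. t \<in> A) M) True" for M
    unfolding pmf_map by (intro arg_cong[where f = "measure _"]) auto
  show ?thesis unfolding * map_bind_pmf pmf_bind_sum ..
qed

text \<open>The stop coin is coded into the public string, so both players see it. A stopped run is
  independent of the inputs and contributes nothing to the convex bound of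
  \<open>channel_info_mix\<close>.\<close>

lemma IC_ext_mu_error_le:
  fixes f :: "'x::finite \<Rightarrow> 'y::finite \<Rightarrow> 'z"
  assumes \<epsilon>: "0 \<le> \<epsilon>" "\<epsilon> < 1"
  shows "IC_ext_mu \<mu> f \<epsilon> \<le> (1 - \<epsilon>) * IC_ext_mu \<mu> f 0"
proof -
  have *: "IC_ext_mu \<mu> f \<epsilon> \<le> (1 - \<epsilon>) * IC_ext_protocol \<mu> P"
    if P: "finite_protocol P" "performs P f 0" for P :: "('x, 'y, 'z) protocol"
  proof -
    define dec :: "nat \<Rightarrow> nat \<times> bool" where "dec = from_nat"
    define P' where "P' = P\<lparr>
      pub := map_pmf to_nat (pair_pmf (pub P) (bernoulli_pmf \<epsilon>)),
      speaker := \<lambda>n h. if snd (dec n) then None else speaker P (fst (dec n)) h,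
      msgA := \<lambda>x n. msgA P x (fst (dec n)), msgB := \<lambda>y n. msgB P y (fst (dec n)),
      out := \<lambda>n. out P (fst (dec n))\<rparr>"
    define K where "K c xy = map_pmf (\<lambda>t. (to_nat (fst t, c), snd t))
      (if c then map_pmf (\<lambda>r. (r, [])) (pub P) else transcript P (fst xy) (snd xy))"
      for c and xy :: "'x \<times> 'y"
    have run: "run P' x y (to_nat (r, c)) a b n h = (if c then h else run P x y r a b n h)" for x y r c a b n h
      by (induction n arbitrary: h) (auto simp: P'_def dec_def split: option.split bool.split)
    have tr: "transcript P' x y = bind_pmf (bernoulli_pmf \<epsilon>) (\<lambda>c. K c (x, y))" for x y
    proof -
      have sel: "pub P' = map_pmf to_nat (pair_pmf (pub P) (bernoulli_pmf \<epsilon>))"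
          "privA P' = privA P" "privB P' = privB P" "depth P' = depth P"
        by (simp_all add: P'_def)
      have "transcript P' x y = bind_pmf (pub P) (\<lambda>r. bind_pmf (bernoulli_pmf \<epsilon>) (\<lambda>c.
          map_pmf (\<lambda>(a, b). (to_nat (r, c), if c then [] else run P x y r a b (depth P) []))
            (pair_pmf (privA P) (privB P))))"
        unfolding transcript_def
        by (simp add: sel pair_pmf_def map_pmf_def bind_assoc_pmf bind_return_pmf run)
      also have "\<dots> = bind_pmf (bernoulli_pmf \<epsilon>) (\<lambda>c. bind_pmf (pub P) (\<lambda>r.
          map_pmf (\<lambda>(a, b). (to_nat (r, c), if c then [] else run P x y r a b (depth P) []))
            (pair_pmf (privA P) (privB P))))" by (rule bind_commute_pmf)
      also have "\<dots> = bind_pmf (bernoulli_pmf \<epsilon>) (\<lambda>c. K c (x, y))"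
      proof (rule bind_pmf_cong[OF refl])
        fix c
        show "bind_pmf (pub P) (\<lambda>r.
          map_pmf (\<lambda>(a, b). (to_nat (r, c), if c then [] else run P x y r a b (depth P) []))
            (pair_pmf (privA P) (privB P))) = K c (x, y)"
          by (cases c) (simp_all add: K_def transcript_def pair_pmf_def map_pmf_def bind_assoc_pmf bind_return_pmf)
      qed
      finally show ?thesis .
    qed
    have fin: "finite_protocol P'" using P(1) by (simp add: P'_def finite_protocol_def)
    have "performs P' f \<epsilon>" unfolding performs_def
    proof (intro allI)
      fix x y
      let ?A = "{t. out P' (fst t) (snd t) \<noteq> f x y}"
      have "set_pmf (K False (x, y)) \<inter> ?A = {}"
        using performs_0_out[OF P(2)] by (auto simp: K_def P'_def dec_def)
      then have "measure_pmf.prob (K False (x, y)) ?A = 0" by (simp only: measure_pmf_zero_iff)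
      then have "measure_pmf.prob (transcript P' x y) ?A = \<epsilon> * measure_pmf.prob (K True (x, y)) ?A"
        unfolding tr prob_bind_sum using \<epsilon> by (simp add: UNIV_bool)
      also have "\<dots> \<le> \<epsilon>" using \<epsilon> by (simp add: mult_left_le)
      finally show "measure_pmf.prob (transcript P' x y) ?A \<le> \<epsilon>" .
    qed
    then have "IC_ext_mu \<mu> f \<epsilon> \<le> IC_ext_protocol \<mu> P'" by (rule IC_ext_mu_le[OF fin])
    also have "\<dots> = channel_info \<mu> (\<lambda>xy. bind_pmf (bernoulli_pmf \<epsilon>) (\<lambda>c. K c xy))"
      unfolding IC_ext_protocol_eq tr by simp
    also have "\<dots> \<le> (\<Sum>c\<in>UNIV. pmf (bernoulli_pmf \<epsilon>) c * channel_info \<mu> (K c))"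
      using P(1) finite_transcript[OF P(1)] by (intro channel_info_mix) (auto simp: K_def finite_protocol_def)
    also have "\<dots> = \<epsilon> * channel_info \<mu> (K True) + (1 - \<epsilon>) * channel_info \<mu> (K False)"
      using \<epsilon> by (simp add: UNIV_bool)
    also have "channel_info \<mu> (K True) = 0"
      unfolding K_def using P(1) by (simp add: channel_info_const finite_protocol_def)
    also have "channel_info \<mu> (K False) \<le> IC_ext_protocol \<mu> P"
      unfolding K_def IC_ext_protocol_eq using finite_transcript[OF P(1)]
      by (simp add: channel_info_map_le)
    finally show ?thesis using \<epsilon> by (simp add: mult_left_mono)
  qed
  \<comment> \<open>Division by \<open>1 - \<epsilon>\<close> turns the estimate for each
    \<open>P\<close> into a lower bound on the zero-error infimum.\<close>
  have "IC_ext_mu \<mu> f \<epsilon> / (1 - \<epsilon>) \<le> IC_ext_mu \<mu> f 0"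
    by (rule le_IC_ext_mu) (use * \<epsilon> in \<open>auto simp: field_simps\<close>)
  then show ?thesis using \<epsilon> by (simp add: field_simps)
qed

section \<open>Resampling the inputs\<close>

definition resample :: "real \<Rightarrow> 'a pmf \<Rightarrow> 'a \<Rightarrow> 'a pmf" where
  "resample \<eta> \<nu> x = bind_pmf (bernoulli_pmf \<eta>) (\<lambda>c. if c then \<nu> else return_pmf x)"

text \<open>The fresh input is drawn even if it is then discarded; this matches the private random
  number used in \<open>resampled_protocol\<close>.\<close>

lemma resample_alt:
  "resample \<eta> \<nu> x
    = bind_pmf (bernoulli_pmf \<eta>) (\<lambda>c. bind_pmf \<nu> (\<lambda>x'. return_pmf (if c then x' else x)))"
  unfolding resample_def by (intro bind_pmf_cong refl) (simp add: bind_return_pmf')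

lemma pmf_resample:
  "0 \<le> \<eta> \<Longrightarrow> \<eta> \<le> 1 \<Longrightarrow> pmf (resample \<eta> \<nu> x) x' = \<eta> * pmf \<nu> x' + (1 - \<eta>) * of_bool (x = x')"
  unfolding resample_def pmf_bind_sum by (simp add: UNIV_bool indicator_def)

lemma resample_invariant:
  fixes \<nu> :: "'a::finite pmf"
  assumes "0 \<le> \<eta>" "\<eta> \<le> 1"
  shows "(\<Sum>x\<in>UNIV. pmf \<nu> x * pmf (resample \<eta> \<nu> x) x') = pmf \<nu> x'"
proof -
  have "(\<Sum>x\<in>UNIV. pmf \<nu> x * pmf (resample \<eta> \<nu> x) x')
      = (\<Sum>x\<in>UNIV. pmf \<nu> x * (\<eta> * pmf \<nu> x') + (if x = x' then pmf \<nu> x * (1 - \<eta>) else 0))"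
    using assms by (intro sum.cong refl) (auto simp: pmf_resample algebra_simps)
  also have "\<dots> = \<eta> * pmf \<nu> x' + pmf \<nu> x' * (1 - \<eta>)"
    by (simp add: sum.distrib sum_distrib_right[symmetric] sum_pmf_eq_1)
  finally show ?thesis by (simp add: algebra_simps)
qed

text \<open>Each marginal is stationary, and the sum factorises because the input law and the
  resampling are both products.\<close>

lemma pair_resample_invariant:
  fixes \<mu>1 :: "'x::finite pmf" and \<mu>2 :: "'y::finite pmf"
  assumes "0 \<le> \<eta>" "\<eta> \<le> 1"
  shows "bind_pmf (pair_pmf \<mu>1 \<mu>2) (\<lambda>xy. pair_pmf (resample \<eta> \<mu>1 (fst xy)) (resample \<eta> \<mu>2 (snd xy)))
    = pair_pmf \<mu>1 \<mu>2"
proof (rule pmf_eqI)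
  fix xy' :: "'x \<times> 'y"
  obtain x' y' where xy': "xy' = (x', y')" by fastforce
  have "pmf (bind_pmf (pair_pmf \<mu>1 \<mu>2) (\<lambda>xy. pair_pmf (resample \<eta> \<mu>1 (fst xy)) (resample \<eta> \<mu>2 (snd xy)))) xy'
     = (\<Sum>(x, y)\<in>UNIV \<times> UNIV. (pmf \<mu>1 x * pmf (resample \<eta> \<mu>1 x) x') * (pmf \<mu>2 y * pmf (resample \<eta> \<mu>2 y) y'))"
    unfolding pmf_bind_sum UNIV_Times_UNIV[symmetric] xy'
    by (intro sum.cong refl) (auto simp: pmf_pair)
  also have "\<dots> = pmf \<mu>1 x' * pmf \<mu>2 y'"
    unfolding sum.cartesian_product[symmetric] sum_product[symmetric] resample_invariant[OF assms] ..
  finally show "pmf (bind_pmf (pair_pmf \<mu>1 \<mu>2)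
      (\<lambda>xy. pair_pmf (resample \<eta> \<mu>1 (fst xy)) (resample \<eta> \<mu>2 (snd xy)))) xy' = pmf (pair_pmf \<mu>1 \<mu>2) xy'"
    by (simp add: xy' pmf_pair)
qed

text \<open>Coin and replacement input are coded into the private random number. All draws are
  independent, so the replacements can be moved to the front, which exhibits a run of
  \<open>P\<close> on the resampled inputs.\<close>

lemma resampled_protocol:
  fixes P :: "('x::finite, 'y::finite, 'z) protocol"
  assumes "finite_protocol P"
  obtains P' where "finite_protocol P'" "out P' = out P"
    "\<And>x y. transcript P' x y = bind_pmf (pair_pmf (resample \<eta> \<mu>1 x) (resample \<eta> \<mu>2 y))
      (\<lambda>xy. transcript P (fst xy) (snd xy))"
proof
  define decA :: "nat \<Rightarrow> nat \<times> bool \<times> 'x" where "decA = from_nat"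
  define decB :: "nat \<Rightarrow> nat \<times> bool \<times> 'y" where "decB = from_nat"
  define selA where "selA n x = (if fst (snd (decA n)) then snd (snd (decA n)) else x)" for n x
  define selB where "selB n y = (if fst (snd (decB n)) then snd (snd (decB n)) else y)" for n y
  define P' where "P' = P\<lparr>
    privA := map_pmf to_nat (pair_pmf (privA P) (pair_pmf (bernoulli_pmf \<eta>) \<mu>1)),
    privB := map_pmf to_nat (pair_pmf (privB P) (pair_pmf (bernoulli_pmf \<eta>) \<mu>2)),
    msgA := \<lambda>x r n. msgA P (selA n x) r (fst (decA n)),
    msgB := \<lambda>y r n. msgB P (selB n y) r (fst (decB n))\<rparr>"
  have sel: "pub P' = pub P" "depth P' = depth P"
      "privA P' = map_pmf to_nat (pair_pmf (privA P) (pair_pmf (bernoulli_pmf \<eta>) \<mu>1))"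
      "privB P' = map_pmf to_nat (pair_pmf (privB P) (pair_pmf (bernoulli_pmf \<eta>) \<mu>2))"
    by (simp_all add: P'_def)
  show "out P' = out P" by (simp add: P'_def)
  show "finite_protocol P'" using assms by (simp add: finite_protocol_def sel)
  fix x y
  have run: "run P' x y r (to_nat (a, c, x')) (to_nat (b, d, y')) n h
      = run P (if c then x' else x) (if d then y' else y) r a b n h" for r a c x' b d y' n h
    by (induction n arbitrary: h)
      (auto simp: P'_def decA_def decB_def selA_def selB_def split: option.split bool.split)
  define SA where "SA = resample \<eta> \<mu>1 x"
  define SB where "SB = resample \<eta> \<mu>2 y"
  define G where "G r a b x' y' = return_pmf (r, run P x' y' r a b (depth P) [])" for r a b x' y'
  have "transcript P' x y = bind_pmf (pub P) (\<lambda>r. bind_pmf (privA P) (\<lambda>a. bind_pmf SA (\<lambda>x'.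
      bind_pmf (privB P) (\<lambda>b. bind_pmf SB (\<lambda>y'. G r a b x' y')))))"
    unfolding transcript_def SA_def SB_def resample_alt G_def
    by (simp add: sel pair_pmf_def map_pmf_def bind_assoc_pmf bind_return_pmf run)
  also have "\<dots> = bind_pmf SA (\<lambda>x'. bind_pmf SB (\<lambda>y'. bind_pmf (pub P) (\<lambda>r. bind_pmf (privA P)
      (\<lambda>a. bind_pmf (privB P) (\<lambda>b. G r a b x' y')))))"
    unfolding bind_commute_pmf[of SB "pub P"] bind_commute_pmf[of SB "privA P"]
      bind_commute_pmf[of SB "privB P"] bind_commute_pmf[of SA "pub P"] bind_commute_pmf[of SA "privA P"] ..
  also have "\<dots> = bind_pmf (pair_pmf SA SB) (\<lambda>xy. transcript P (fst xy) (snd xy))"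
    unfolding transcript_def G_def
    by (simp add: pair_pmf_def map_pmf_def bind_assoc_pmf bind_return_pmf)
  finally show "transcript P' x y = bind_pmf (pair_pmf (resample \<eta> \<mu>1 x) (resample \<eta> \<mu>2 y))
      (\<lambda>xy. transcript P (fst xy) (snd xy))" unfolding SA_def SB_def .
qed

lemma xlog_inverse_bounds:
  fixes q lo hi :: real
  assumes "0 < lo" "lo \<le> q" "q \<le> hi" "hi \<le> 1"
  shows "lo * log 2 (1 / hi) \<le> q * log 2 (1 / q)"
  using assms by (intro mult_mono) (auto intro!: divide_left_mono)

text \<open>Only one coordinate may change: such a move has probability of order
  \<open>\<epsilon>\<close>, whereas changing both would give only \<open>\<epsilon>^2\<close>. In
  \<open>\<delta> ^ 3\<close>, two factors bound the weight of \<open>(x, y)\<close> and one the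
  chance of drawing the new coordinate.\<close>

lemma IC_ext_mu_product_gain:
  fixes f :: "'x::finite \<Rightarrow> 'y::finite \<Rightarrow> 'z"
  assumes \<epsilon>: "0 < \<epsilon>" "\<epsilon> \<le> 1" and \<delta>: "0 < \<delta>"
    and heavy: "\<delta> \<le> pmf \<mu>1 x" "\<delta> \<le> pmf \<mu>1 x'" "\<delta> \<le> pmf \<mu>2 y" "\<delta> \<le> pmf \<mu>2 y'"
    and adj: "x = x' \<or> y = y'" and neq: "f x y \<noteq> f x' y'"
  shows "IC_ext_mu (pair_pmf \<mu>1 \<mu>2) f \<epsilon> + \<delta> ^ 3 / 4 * (\<epsilon> * log 2 (1 / \<epsilon>))
    \<le> IC_ext_mu (pair_pmf \<mu>1 \<mu>2) f 0"
proof (rule le_IC_ext_mu)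
  fix P :: "('x, 'y, 'z) protocol"
  assume P: "finite_protocol P" "performs P f 0"
  \<comment> \<open>Half of the error budget for each player.\<close>
  define \<eta> where "\<eta> = \<epsilon> / 2"
  have \<eta>: "0 \<le> \<eta>" "\<eta> \<le> 1" "0 < \<eta>" "\<eta> \<le> 1/2" using \<epsilon> by (auto simp: \<eta>_def)
  define \<mu> where "\<mu> = pair_pmf \<mu>1 \<mu>2"
  define W where "W xy = pair_pmf (resample \<eta> \<mu>1 (fst xy)) (resample \<eta> \<mu>2 (snd xy))" for xy
  define F where "F xy = f (fst xy) (snd xy)" for xy
  define K where "K xy = transcript P (fst xy) (snd xy)" for xy
  obtain P' where P': "finite_protocol P'" "out P' = out P"
    and tr: "\<And>x y. transcript P' x y = bind_pmf (W (x, y)) K"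
    using resampled_protocol[OF P(1), of \<eta> \<mu>1 \<mu>2] unfolding W_def K_def fst_conv snd_conv by blast
  have stay: "1 - \<epsilon> \<le> pmf (W xy) xy" for xy
  proof -
    have "1 - \<epsilon> \<le> (1 - \<eta>) * (1 - \<eta>)" using \<eta> by (simp add: \<eta>_def algebra_simps)
    also have "\<dots> \<le> pmf (resample \<eta> \<mu>1 (fst xy)) (fst xy) * pmf (resample \<eta> \<mu>2 (snd xy)) (snd xy)"
      using \<eta> by (intro mult_mono) (auto simp: pmf_resample)
    finally show ?thesis by (cases xy) (simp add: W_def pmf_pair)
  qed
  have move: "measure_pmf.prob (W xy) (- {xy}) \<le> \<epsilon>" for xy
    using stay[of xy] measure_pmf.prob_compl[of "{xy}" "W xy"] by (simp add: Compl_eq_Diff_UNIV measure_pmf_single)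
  have Kout: "out P (fst t) (snd t) = F b" if "t \<in> set_pmf (K b)" for t b
    using performs_0_out[OF P(2)] that unfolding K_def F_def by blast
  have "performs P' f \<epsilon>" unfolding performs_def
  proof (intro allI)
    fix u v
    let ?A = "{t. out P' (fst t) (snd t) \<noteq> f u v}"
    have "measure_pmf.prob (K b) ?A \<le> of_bool (b \<in> - {(u, v)})" for b
    proof (cases "b = (u, v)")
      case True
      then have "set_pmf (K b) \<inter> ?A = {}" using Kout P'(2) by (auto simp: F_def)
      then have "measure_pmf.prob (K b) ?A = 0" by (simp only: measure_pmf_zero_iff)
      then show ?thesis by simp
    qed simp
    then have "measure_pmf.prob (transcript P' u v) ?A
        \<le> (\<Sum>b\<in>UNIV. pmf (W (u, v)) b * of_bool (b \<in> - {(u, v)}))"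
      unfolding tr prob_bind_sum by (intro sum_mono mult_left_mono) auto
    also have "\<dots> = measure_pmf.prob (W (u, v)) (- {(u, v)})"
      by (auto simp: measure_measure_pmf_finite of_bool_def if_distrib sum.If_cases cong: if_cong intro!: sum.cong)
    finally show "measure_pmf.prob (transcript P' u v) ?A \<le> \<epsilon>" using move[of "(u, v)"] by linarith
  qed
  then have 1: "IC_ext_mu \<mu> f \<epsilon> \<le> channel_info \<mu> (\<lambda>a. bind_pmf (W a) K)"
    using IC_ext_mu_le[OF P'(1), of f \<epsilon> \<mu>] unfolding IC_ext_protocol_eq tr by simp
  define q where "q = pmf (map_pmf F (W (x, y))) (f x' y')"
  have q_prob: "q = measure_pmf.prob (W (x, y)) (F -` {f x' y'})" unfolding q_def by (rule pmf_map)
  have "q \<le> measure_pmf.prob (W (x, y)) (- {(x, y)})"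
    unfolding q_prob using neq by (intro measure_pmf.finite_measure_mono) (auto simp: F_def)
  then have q_hi: "q \<le> \<epsilon>" using move[of "(x, y)"] by linarith
  have d1: "\<delta> \<le> 1" using heavy(1) pmf_le_1[of \<mu>1 x] by linarith
  have ne: "x \<noteq> x' \<or> y \<noteq> y'" using neq by auto
  \<comment> \<open>The changed coordinate contributes \<open>\<eta> * \<delta>\<close>; the other
    one stays with probability at least \<open>1 - \<eta> \<ge> 1 / 2\<close>.\<close>
  have "\<eta> * \<delta> * (1 / 2) \<le> pmf (W (x, y)) (x', y')"
  proof -
    have r1: "\<eta> * \<delta> \<le> pmf (resample \<eta> \<mu>1 x) x'" and r2: "\<eta> * \<delta> \<le> pmf (resample \<eta> \<mu>2 y) y'"
      using \<eta> heavy by (auto simp: pmf_resample intro: add_increasing2 mult_left_mono)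
    have r3: "1 / 2 \<le> pmf (resample \<eta> \<mu>1 x) x'" if "x = x'"
    proof -
      have "1 - \<eta> \<le> pmf (resample \<eta> \<mu>1 x) x'" using that \<eta> by (simp add: pmf_resample)
      then show ?thesis using \<eta> by simp
    qed
    have r4: "1 / 2 \<le> pmf (resample \<eta> \<mu>2 y) y'" if "y = y'"
    proof -
      have "1 - \<eta> \<le> pmf (resample \<eta> \<mu>2 y) y'" using that \<eta> by (simp add: pmf_resample)
      then show ?thesis using \<eta> by simp
    qed
    show ?thesis
    proof (cases "x = x'")
      case True
      have "1 / 2 * (\<eta> * \<delta>) \<le> pmf (resample \<eta> \<mu>1 x) x' * pmf (resample \<eta> \<mu>2 y) y'"
        using r2 r3[OF True] \<eta> \<delta> by (intro mult_mono) auto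
      then show ?thesis by (simp add: W_def pmf_pair mult.commute)
    next
      case False
      then have "y = y'" using adj by simp
      then have "\<eta> * \<delta> * (1 / 2) \<le> pmf (resample \<eta> \<mu>1 x) x' * pmf (resample \<eta> \<mu>2 y) y'"
        using r1 r4 \<eta> \<delta> by (intro mult_mono) auto
      then show ?thesis by (simp add: W_def pmf_pair)
    qed
  qed
  also have "\<dots> \<le> q"
    unfolding q_prob measure_pmf_single[symmetric]
    by (intro measure_pmf.finite_measure_mono) (auto simp: F_def)
  finally have q_lo: "\<epsilon> * \<delta> / 4 \<le> q" by (simp add: \<eta>_def)
  have qlog: "\<epsilon> * \<delta> / 4 * log 2 (1 / \<epsilon>) \<le> q * log 2 (1 / q)"
    using \<epsilon> \<delta> q_lo q_hi by (intro xlog_inverse_bounds) auto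
  have "\<delta> * \<delta> \<le> pmf \<mu> (x, y)"
    unfolding \<mu>_def pmf_pair using heavy \<delta> by (intro mult_mono) auto
  then have "\<delta> * \<delta> * (\<epsilon> * \<delta> / 4 * log 2 (1 / \<epsilon>)) \<le> pmf \<mu> (x, y) * (q * log 2 (1 / q))"
    using qlog \<epsilon> \<delta> by (intro mult_mono[OF _ qlog]) auto
  moreover have "channel_info \<mu> (\<lambda>a. bind_pmf (W a) K) + pmf \<mu> (x, y) * (q * log 2 (1 / q)) \<le> channel_info \<mu> K"
  proof -
    have K: "finite (set_pmf (K a))" for a unfolding K_def by (rule finite_transcript[OF P(1)])
    have inv: "bind_pmf \<mu> W = \<mu>"
      unfolding \<mu>_def W_def by (rule pair_resample_invariant[OF \<eta>(1,2)])
    show ?thesis by (rule channel_info_resample[OF K inv _ q_def]) (rule Kout)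
  qed
  moreover have "channel_info \<mu> K = IC_ext_protocol \<mu> P" unfolding IC_ext_protocol_eq K_def ..
  ultimately show "IC_ext_mu (pair_pmf \<mu>1 \<mu>2) f \<epsilon> + \<delta> ^ 3 / 4 * (\<epsilon> * log 2 (1 / \<epsilon>)) \<le> IC_ext_protocol (pair_pmf \<mu>1 \<mu>2) P"
    using 1 unfolding \<mu>_def[symmetric] by (simp add: power3_eq_cube mult_ac)
qed simp

section \<open>Alarms and numerical bounds\<close>

text \<open>The constant \<open>3 / 2\<close> comes from \<open>ln 2 \<ge> 2 / 3\<close>; the second
  bound loses a further factor 2 through \<open>1 - p \<ge> 1 / 2\<close>.\<close>

lemma log2_inverse_one_minus_le:
  assumes "0 \<le> p" "p \<le> 1 / 2"
  shows "(1 - p) * log 2 (1 / (1 - p)) \<le> 3 / 2 * p" "log 2 (1 / (1 - p)) \<le> 3 * p"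
proof -
  have "ln (1 / (1 - p)) \<le> 1 / (1 - p) - 1" using assms by (intro ln_le_minus_one) simp
  then have "(1 - p) * ln (1 / (1 - p)) \<le> (1 - p) * (1 / (1 - p) - 1)"
    using assms by (intro mult_left_mono) auto
  also have "\<dots> = p" using assms by (simp add: right_diff_distrib)
  finally have 1: "(1 - p) * ln (1 / (1 - p)) \<le> p" .
  have "p \<le> 3 / 2 * p * ln 2" using ln2_ge_two_thirds assms mult_left_mono[of "2/3" "ln 2" "3 / 2 * p"] by simp
  then have "(1 - p) * ln (1 / (1 - p)) / ln 2 \<le> 3 / 2 * p"
    using 1 by (simp add: pos_divide_le_eq)
  then show 2: "(1 - p) * log 2 (1 / (1 - p)) \<le> 3 / 2 * p" by (simp add: log_def)
  have "0 \<le> log 2 (1 / (1 - p))" using assms by simp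
  then have "1 / 2 * log 2 (1 / (1 - p)) \<le> (1 - p) * log 2 (1 / (1 - p))"
    using assms by (intro mult_right_mono) auto
  then show "log 2 (1 / (1 - p)) \<le> 3 * p" using 2 by simp
qed

lemma patch_cost_le:
  assumes p: "0 \<le> p" "p \<le> p0" and p0: "0 < p0" "p0 \<le> 1 / 2" and N: "1 \<le> N"
  shows "(1 - p) * log 2 (1 / (1 - p0)) + p * log 2 (N / p0) \<le> p0 * (3 + log 2 (N / p0))"
proof -
  have "0 \<le> log 2 (1 / (1 - p0))" "0 \<le> log 2 (N / p0)" using p0 N by auto
  then have "(1 - p) * log 2 (1 / (1 - p0)) \<le> log 2 (1 / (1 - p0))"
    and "p * log 2 (N / p0) \<le> p0 * log 2 (N / p0)"
    using p p0 by (auto intro!: mult_left_le_one_le mult_right_mono)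
  then show ?thesis using log2_inverse_one_minus_le(2)[of p0] p0 unfolding distrib_left by linarith
qed

lemma bin_entropy_eq:
  assumes "0 < s" "s < 1"
  shows "bin_entropy s = s * log 2 (1 / s) + (1 - s) * log 2 (1 / (1 - s))"
  using assms by (simp add: bin_entropy_def xlog2_def log_divide)

lemma le_log2_inverse: "0 < s \<Longrightarrow> s \<le> 1 / 4 \<Longrightarrow> 2 \<le> log 2 (1 / s)"
  by (subst le_log_iff) (auto simp: field_simps)

lemma bin_entropy_ge: "0 < s \<Longrightarrow> s < 1 \<Longrightarrow> s * log 2 (1 / s) \<le> bin_entropy s"
  by (simp add: bin_entropy_eq)

lemma bin_entropy_le:
  assumes "0 < s" "s \<le> 1 / 4"
  shows "bin_entropy s \<le> 2 * (s * log 2 (1 / s))"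
proof -
  have "3 / 2 * s \<le> s * log 2 (1 / s)"
    using le_log2_inverse[OF assms] assms by (simp add: mult.commute)
  then show ?thesis
    using log2_inverse_one_minus_le(1)[of s] assms bin_entropy_eq[of s] by linarith
qed

text \<open>Makes \<open>v * log 2 (1 / v)\<close> at most \<open>3 * sqrt v\<close>; applied to the
  heaviness threshold and to \<open>\<epsilon>\<close>.\<close>

lemma log2_inverse_le:
  assumes "0 < u"
  shows "log 2 (1 / u\<^sup>2) \<le> 3 / u"
proof -
  have "ln (1 / u) \<le> 1 / u - 1" using assms by (intro ln_le_minus_one) simp
  then have "2 * ln (1 / u) \<le> 2 / u" by simp
  also have "2 / u \<le> 3 / u * ln 2"
    using assms ln2_ge_two_thirds mult_left_mono[of "2/3" "ln 2" "3 / u"] by simp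
  finally have "2 * ln (1 / u) / ln 2 \<le> 3 / u" by (simp add: pos_divide_le_eq)
  moreover have "ln (1 / u\<^sup>2) = 2 * ln (1 / u)"
    using assms by (simp add: ln_div ln_realpow)
  ultimately show ?thesis by (simp add: log_def)
qed

section \<open>Choice of the alarms\<close>

lemma measure_pmf_sum:
  assumes "finite S" "set_pmf M \<subseteq> S"
  shows "measure_pmf.prob M A = (\<Sum>t\<in>S. pmf M t * of_bool (t \<in> A))"
proof -
  have "measure_pmf.prob M A = measure_pmf.prob M (S \<inter> A)"
    using assms(2) by (intro measure_prob_cong_0) (auto simp: set_pmf_iff)
  also have "\<dots> = (\<Sum>t\<in>S \<inter> A. pmf M t)" using assms(1) by (simp add: measure_measure_pmf_finite)
  also have "\<dots> = (\<Sum>t\<in>S. pmf M t * of_bool (t \<in> A))"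
    using assms(1) by (intro sum.mono_neutral_cong_left) auto
  finally show ?thesis .
qed

text \<open>Every wrong pair \<open>(x, y)\<close> at a transcript is charged to one player. Charging it to Alice exactly
  when Bob's factor at \<open>y\<close> is not much smaller than its average given \<open>x\<close> makes
  both players' alarms rare under the true input distribution.\<close>

lemma rare_alarms:
  fixes f :: "'x::finite \<Rightarrow> 'y::finite \<Rightarrow> 'z" and P :: "('x, 'y, 'z) protocol"
  assumes fin: "finite_protocol P" and perf: "performs P f (s\<^sup>2)" and s: "0 < s"
  obtains badA badB where
    "\<And>x y t. out P (fst t) (snd t) \<noteq> f x y \<Longrightarrow> badA t x \<or> badB t y"
    "(\<Sum>xy\<in>UNIV. pmf \<mu> xy *
      measure_pmf.prob (transcript P (fst xy) (snd xy)) {t. badA t (fst xy) \<or> badB t (snd xy)})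
      \<le> (real CARD('x) + real CARD('y)) * s"
proof -
  obtain A B where AB: "\<And>x y t. pmf (transcript P x y) t = A x t * B y t"
    and A0: "\<And>x t. 0 \<le> A x t" and B0: "\<And>y t. 0 \<le> (B y t :: real)"
    using transcript_rectangle[of P] by metis
  define S where "S = (\<Union>x y. set_pmf (transcript P x y))"
  have S: "finite S" unfolding S_def using finite_transcript[OF fin] by auto
  have sub: "set_pmf (transcript P x y) \<subseteq> S" for x y unfolding S_def by blast
  have AB1: "(\<Sum>t\<in>S. A x t * B y t) = 1" for x y
    using sum_pmf_eq_1[OF S sub, of x y] unfolding AB .
  define m where "m x y = pmf \<mu> (x, y)" for x y
  have m0: "0 \<le> m x y" for x y by (simp add: m_def)
  have m1: "(\<Sum>x\<in>UNIV. \<Sum>y\<in>UNIV. m x y) = 1"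
    unfolding m_def sum.cartesian_product using sum_pmf_eq_1[of UNIV \<mu>] by simp
  define mX where "mX x = (\<Sum>y\<in>UNIV. m x y)" for x
  define mY where "mY y = (\<Sum>x\<in>UNIV. m x y)" for y
  have mX0: "0 \<le> mX x" for x unfolding mX_def by (intro sum_nonneg m0)
  have mX1: "(\<Sum>x\<in>UNIV. mX x) = 1" unfolding mX_def by (rule m1)
  have mY1: "(\<Sum>y\<in>UNIV. mY y) = 1" unfolding mY_def by (subst sum.swap) (rule m1)
  define avgB where "avgB x t = (\<Sum>y\<in>UNIV. m x y * B y t)" for x t
  define avgA where "avgA y t = (\<Sum>x\<in>UNIV. m x y * A x t)" for y t
  have avg0: "0 \<le> avgB x t" "0 \<le> avgA y t" for x y t
    unfolding avgA_def avgB_def by (intro sum_nonneg mult_nonneg_nonneg m0 A0 B0)+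
  define err where "err x y t \<longleftrightarrow> out P (fst t) (snd t) \<noteq> f x y" for x y t
  \<comment> \<open>\<open>avgB x t\<close> is \<open>mX x\<close> times the average of
    \<open>B\<close> given \<open>x\<close>, which explains the factor \<open>mX x\<close> in the
    comparison. If \<open>mX x = 0\<close>, charging Alice costs nothing.\<close>
  define toA where "toA x y t \<longleftrightarrow> mX x = 0 \<or> s * avgB x t < mX x * B y t" for x y t
  define badA where "badA t x \<longleftrightarrow> (\<exists>y. err x y t \<and> toA x y t)" for t x
  define badB where "badB t y \<longleftrightarrow> (\<exists>x. err x y t \<and> \<not> toA x y t)" for t y
  have errsum: "(\<Sum>t\<in>S. of_bool (err x y t) * (A x t * B y t)) \<le> s\<^sup>2" for x y
  proof -
    have "measure_pmf.prob (transcript P x y) {t. err x y t} \<le> s\<^sup>2"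
      using perf unfolding performs_def err_def by blast
    then show ?thesis
      unfolding measure_pmf_sum[OF S sub] AB mem_Collect_eq by (simp only: mult.commute)
  qed
  \<comment> \<open>\<open>A x t * avgB x t\<close> is the joint probability of \<open>x\<close> and
    \<open>t\<close>. Under \<open>toA\<close> it is at most \<open>mX x / s\<close> times the
    probability of \<open>t\<close> on \<open>(x, y)\<close>, and the wrong transcripts there have
    total probability at most \<open>s^2\<close>.\<close>
  have alice: "(\<Sum>t\<in>S. of_bool (err x y t \<and> toA x y t) * (A x t * avgB x t)) \<le> mX x * s" for x y
  proof -
    have "s * (of_bool (err x y t \<and> toA x y t) * (A x t * avgB x t))
        \<le> mX x * (of_bool (err x y t) * (A x t * B y t))" for t
    proof (cases "mX x = 0")
      case True
      then have "m x y' = 0" for y'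
        using sum_nonneg_eq_0_iff[of UNIV "m x"] m0 unfolding mX_def by auto
      then show ?thesis using True by (simp add: avgB_def)
    next
      case False
      then have "s * avgB x t \<le> mX x * B y t" if "toA x y t" using that by (simp add: toA_def)
      then have "A x t * (s * avgB x t) \<le> A x t * (mX x * B y t)" if "toA x y t"
        using that A0 by (intro mult_left_mono) auto
      then show ?thesis using A0[of x t] B0[of y t] mX0[of x] by (auto simp: mult_ac)
    qed
    then have "(\<Sum>t\<in>S. s * (of_bool (err x y t \<and> toA x y t) * (A x t * avgB x t)))
        \<le> (\<Sum>t\<in>S. mX x * (of_bool (err x y t) * (A x t * B y t)))" by (rule sum_mono)
    also have "\<dots> = mX x * (\<Sum>t\<in>S. of_bool (err x y t) * (A x t * B y t))"
      by (rule sum_distrib_left[symmetric])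
    also have "\<dots> \<le> mX x * s\<^sup>2" using errsum mX0 by (rule mult_left_mono)
    finally have "s * (\<Sum>t\<in>S. of_bool (err x y t \<and> toA x y t) * (A x t * avgB x t)) \<le> s * (mX x * s)"
      unfolding sum_distrib_left by (simp add: power2_eq_square mult_ac)
    then show ?thesis using s by simp
  qed
  \<comment> \<open>\<open>B y t * avgA y t\<close> is the joint probability of \<open>y\<close> and
    \<open>t\<close>. The failed comparison bounds \<open>B y t\<close> by
    \<open>s * avgB x t / mX x\<close>, so the smallness now comes from the comparison
    itself.\<close>
  have bob: "(\<Sum>t\<in>S. of_bool (err x y t \<and> \<not> toA x y t) * (B y t * avgA y t)) \<le> mY y * s" for x y
  proof (cases "mX x = 0")
    case True
    have "0 \<le> mY y" unfolding mY_def by (intro sum_nonneg m0)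
    then show ?thesis using True s by (simp add: toA_def)
  next
    case False
    then have mXp: "0 < mX x" using mX0[of x] by simp
    \<comment> \<open>Decisive use of the rectangle property: the hybrid products
      \<open>A x' t * B y' t\<close> are again transcript laws, on \<open>(x', y')\<close>, and sum
      to 1.\<close>
    have "(\<Sum>t\<in>S. avgB x t * avgA y t)
        = (\<Sum>t\<in>S. \<Sum>y'\<in>UNIV. \<Sum>x'\<in>UNIV. m x y' * m x' y * (A x' t * B y' t))"
      unfolding avgA_def avgB_def sum_product by (simp add: mult_ac)
    also have "\<dots> = (\<Sum>y'\<in>UNIV. \<Sum>x'\<in>UNIV. m x y' * m x' y * (\<Sum>t\<in>S. A x' t * B y' t))"
      unfolding sum_distrib_left by (subst sum.swap, rule sum.cong[OF refl], rule sum.swap)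
    also have "\<dots> = mX x * mY y" unfolding AB1 mX_def mY_def sum_product by simp
    finally have avgAB: "(\<Sum>t\<in>S. avgB x t * avgA y t) = mX x * mY y" .
    have "mX x * (of_bool (err x y t \<and> \<not> toA x y t) * (B y t * avgA y t)) \<le> s * (avgB x t * avgA y t)" for t
    proof (cases "err x y t \<and> \<not> toA x y t")
      case True
      then have "mX x * B y t \<le> s * avgB x t" by (simp add: toA_def)
      then have "mX x * B y t * avgA y t \<le> s * avgB x t * avgA y t"
        using avg0 by (intro mult_right_mono) auto
      then show ?thesis using True by (simp add: mult_ac)
    next
      case False
      then show ?thesis using s avg0(1)[of x t] avg0(2)[of y t] by auto
    qed
    then have "(\<Sum>t\<in>S. mX x * (of_bool (err x y t \<and> \<not> toA x y t) * (B y t * avgA y t)))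
        \<le> (\<Sum>t\<in>S. s * (avgB x t * avgA y t))" by (rule sum_mono)
    then have "mX x * (\<Sum>t\<in>S. of_bool (err x y t \<and> \<not> toA x y t) * (B y t * avgA y t)) \<le> mX x * (mY y * s)"
      unfolding sum_distrib_left[symmetric] avgAB by (simp add: mult_ac)
    then show ?thesis using mXp by simp
  qed
  have weightB: "(\<Sum>y\<in>UNIV. m x y * (A x t * B y t * E)) = E * (A x t * avgB x t)" for x t E
    unfolding avgB_def sum_distrib_left by (rule sum.cong[OF refl]) simp
  have weightA: "(\<Sum>x\<in>UNIV. m x y * (A x t * B y t * E)) = E * (B y t * avgA y t)" for y t E
    unfolding avgA_def sum_distrib_left by (rule sum.cong[OF refl]) simp
  \<comment> \<open>Union bound over the unknown input of the other player, the source of the two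
    cardinalities.\<close>
  have union: "(of_bool (badA t x \<or> badB t y) :: real)
      \<le> (\<Sum>y'\<in>UNIV. of_bool (err x y' t \<and> toA x y' t)) + (\<Sum>x'\<in>UNIV. of_bool (err x' y t \<and> \<not> toA x' y t))"
    (is "_ \<le> ?a + ?b") for x y t
  proof -
    have ab0: "0 \<le> ?a" "0 \<le> ?b" by (auto intro: sum_nonneg)
    have "1 \<le> ?a" if A: "badA t x"
    proof -
      obtain y' where "err x y' t \<and> toA x y' t" using A unfolding badA_def by blast
      then show ?thesis
        using member_le_sum[of y' UNIV "\<lambda>y'. of_bool (err x y' t \<and> toA x y' t) :: real"] by simp
    qed
    moreover have "1 \<le> ?b" if B: "badB t y"
    proof -
      obtain x' where "err x' y t \<and> \<not> toA x' y t" using B unfolding badB_def by blast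
      then show ?thesis
        using member_le_sum[of x' UNIV "\<lambda>x'. of_bool (err x' y t \<and> \<not> toA x' y t) :: real"] by simp
    qed
    ultimately have "1 \<le> ?a + ?b" if "badA t x \<or> badB t y"
      using that ab0 by linarith
    moreover have "0 \<le> ?a + ?b" using ab0 by linarith
    ultimately show ?thesis by (cases "badA t x \<or> badB t y") (simp_all only: of_bool_eq)
  qed
  have "(\<Sum>xy\<in>UNIV. pmf \<mu> xy *
      measure_pmf.prob (transcript P (fst xy) (snd xy)) {t. badA t (fst xy) \<or> badB t (snd xy)})
      = (\<Sum>x\<in>UNIV. \<Sum>y\<in>UNIV. m x y * (\<Sum>t\<in>S. A x t * B y t * of_bool (badA t x \<or> badB t y)))"
    unfolding measure_pmf_sum[OF S sub] AB UNIV_Times_UNIV[symmetric] sum.cartesian_product m_def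
    by (intro sum.cong refl) auto
  also have "\<dots> \<le> (\<Sum>x\<in>UNIV. \<Sum>y\<in>UNIV. m x y * (\<Sum>t\<in>S. A x t * B y t *
      ((\<Sum>y'\<in>UNIV. of_bool (err x y' t \<and> toA x y' t)) + (\<Sum>x'\<in>UNIV. of_bool (err x' y t \<and> \<not> toA x' y t)))))"
    using A0 B0 m0 union by (intro sum_mono mult_left_mono) auto
  also have "\<dots> = (\<Sum>x\<in>UNIV. \<Sum>y'\<in>UNIV. \<Sum>t\<in>S. of_bool (err x y' t \<and> toA x y' t) * (A x t * avgB x t))
      + (\<Sum>y\<in>UNIV. \<Sum>x'\<in>UNIV. \<Sum>t\<in>S. of_bool (err x' y t \<and> \<not> toA x' y t) * (B y t * avgA y t))"
  proof -
    have a: "(\<Sum>y\<in>UNIV. m x y * (\<Sum>t\<in>S. A x t * B y t * (\<Sum>y'\<in>UNIV. of_bool (err x y' t \<and> toA x y' t))))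
        = (\<Sum>y'\<in>UNIV. \<Sum>t\<in>S. of_bool (err x y' t \<and> toA x y' t) * (A x t * avgB x t))" for x
    proof -
      have "(\<Sum>y\<in>UNIV. m x y * (\<Sum>t\<in>S. A x t * B y t * (\<Sum>y'\<in>UNIV. of_bool (err x y' t \<and> toA x y' t))))
        = (\<Sum>y\<in>UNIV. \<Sum>t\<in>S. m x y * (A x t * B y t * (\<Sum>y'\<in>UNIV. of_bool (err x y' t \<and> toA x y' t))))"
        by (simp only: sum_distrib_left)
      also have "\<dots> = (\<Sum>t\<in>S. \<Sum>y\<in>UNIV. m x y * (A x t * B y t * (\<Sum>y'\<in>UNIV. of_bool (err x y' t \<and> toA x y' t))))"
        by (rule sum.swap)
      also have "\<dots> = (\<Sum>t\<in>S. (\<Sum>y'\<in>UNIV. of_bool (err x y' t \<and> toA x y' t)) * (A x t * avgB x t))"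
        by (intro sum.cong refl weightB)
      also have "\<dots> = (\<Sum>y'\<in>UNIV. \<Sum>t\<in>S. of_bool (err x y' t \<and> toA x y' t) * (A x t * avgB x t))"
        unfolding sum_distrib_right by (rule sum.swap)
      finally show ?thesis .
    qed
    have b: "(\<Sum>x\<in>UNIV. m x y * (\<Sum>t\<in>S. A x t * B y t * (\<Sum>x'\<in>UNIV. of_bool (err x' y t \<and> \<not> toA x' y t))))
        = (\<Sum>x'\<in>UNIV. \<Sum>t\<in>S. of_bool (err x' y t \<and> \<not> toA x' y t) * (B y t * avgA y t))" for y
    proof -
      have "(\<Sum>x\<in>UNIV. m x y * (\<Sum>t\<in>S. A x t * B y t * (\<Sum>x'\<in>UNIV. of_bool (err x' y t \<and> \<not> toA x' y t))))
        = (\<Sum>x\<in>UNIV. \<Sum>t\<in>S. m x y * (A x t * B y t * (\<Sum>x'\<in>UNIV. of_bool (err x' y t \<and> \<not> toA x' y t))))"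
        by (simp only: sum_distrib_left)
      also have "\<dots> = (\<Sum>t\<in>S. \<Sum>x\<in>UNIV. m x y * (A x t * B y t * (\<Sum>x'\<in>UNIV. of_bool (err x' y t \<and> \<not> toA x' y t))))"
        by (rule sum.swap)
      also have "\<dots> = (\<Sum>t\<in>S. (\<Sum>x'\<in>UNIV. of_bool (err x' y t \<and> \<not> toA x' y t)) * (B y t * avgA y t))"
        by (intro sum.cong refl weightA)
      also have "\<dots> = (\<Sum>x'\<in>UNIV. \<Sum>t\<in>S. of_bool (err x' y t \<and> \<not> toA x' y t) * (B y t * avgA y t))"
        unfolding sum_distrib_right by (rule sum.swap)
      finally show ?thesis .
    qed
    have "(\<Sum>x\<in>UNIV. \<Sum>y\<in>UNIV. m x y * (\<Sum>t\<in>S. A x t * B y t * (\<Sum>x'\<in>UNIV. of_bool (err x' y t \<and> \<not> toA x' y t))))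
        = (\<Sum>y\<in>UNIV. \<Sum>x\<in>UNIV. m x y * (\<Sum>t\<in>S. A x t * B y t * (\<Sum>x'\<in>UNIV. of_bool (err x' y t \<and> \<not> toA x' y t))))"
      by (rule sum.swap)
    then show ?thesis by (simp only: distrib_left sum.distrib a b)
  qed
  also have "\<dots> \<le> (\<Sum>x\<in>UNIV. \<Sum>y'\<in>(UNIV :: 'y set). mX x * s) + (\<Sum>y\<in>UNIV. \<Sum>x'\<in>(UNIV :: 'x set). mY y * s)"
    by (intro add_mono sum_mono alice bob)
  also have "\<dots> = real CARD('y) * ((\<Sum>x\<in>UNIV. mX x) * s) + real CARD('x) * ((\<Sum>y\<in>UNIV. mY y) * s)"
    by (simp add: sum_distrib_left sum_distrib_right)
  also have "\<dots> = (real CARD('x) + real CARD('y)) * s"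
    unfolding mX1 mY1 by (simp add: distrib_right)
  finally have le: "(\<Sum>xy\<in>UNIV. pmf \<mu> xy *
      measure_pmf.prob (transcript P (fst xy) (snd xy)) {t. badA t (fst xy) \<or> badB t (snd xy)})
      \<le> (real CARD('x) + real CARD('y)) * s" .
  have alarm: "badA t x \<or> badB t y" if "out P (fst t) (snd t) \<noteq> f x y" for x y t
    using that unfolding badA_def badB_def err_def by blast
  show ?thesis by (rule that[OF alarm le])
qed

section \<open>From rare alarms to the upper bounds\<close>

lemma card_sum_le: "real CARD('x::finite) + real CARD('y::finite) \<le> 2 * real (CARD('x) * CARD('y))"
proof -
  have "1 \<le> CARD('x)" "1 \<le> CARD('y)" by (simp_all add: Suc_leI)
  then have "CARD('x) * 1 \<le> CARD('x) * CARD('y)" "1 * CARD('y) \<le> CARD('x) * CARD('y)"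
    by (intro mult_mono; simp)+
  then have "CARD('x) + CARD('y) \<le> 2 * (CARD('x) * CARD('y))" by linarith
  then show ?thesis unfolding of_nat_add[symmetric] by (metis of_nat_le_iff of_nat_mult of_nat_numeral)
qed

text \<open>By \<open>card_sum_le\<close> the alarm probability is at most
  \<open>p0 = 2 * N * s\<close>, and the assumption on \<open>s\<close> makes this at most
  \<open>1 / 2\<close>. With this choice \<open>N / p0 = 1 / (2 * s)\<close>, so no cardinality is
  left inside the logarithm.\<close>

lemma IC_ext_mu_patch_small:
  fixes f :: "'x::finite \<Rightarrow> 'y::finite \<Rightarrow> 'z" and P :: "('x, 'y, 'z) protocol"
  assumes fin: "finite_protocol P"
    and bad: "\<And>x y t. t \<in> set_pmf (transcript P x y) \<Longrightarrow> out P (fst t) (snd t) \<noteq> f x y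
        \<Longrightarrow> badA t x \<or> badB t y"
    and s: "0 < s" "4 * real (CARD('x) * CARD('y)) * s \<le> 1"
    and p: "(\<Sum>xy\<in>UNIV. pmf \<mu> xy *
      measure_pmf.prob (transcript P (fst xy) (snd xy)) {t. badA t (fst xy) \<or> badB t (snd xy)})
      \<le> (real CARD('x) + real CARD('y)) * s"
  shows "IC_ext_mu \<mu> f 0 \<le> IC_ext_protocol \<mu> P
    + 2 * real (CARD('x) * CARD('y)) * s * (2 + log 2 (1 / s))"
proof -
  define N where "N = real (CARD('x) * CARD('y))"
  have "1 \<le> CARD('x) * CARD('y)" by (simp add: Suc_leI)
  then have N: "1 \<le> N" unfolding N_def by linarith
  define p0 where "p0 = 2 * N * s"
  have p0: "0 < p0" "p0 \<le> 1 / 2" using N s unfolding p0_def N_def[symmetric] by auto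
  let ?p = "\<Sum>xy\<in>UNIV. pmf \<mu> xy *
      measure_pmf.prob (transcript P (fst xy) (snd xy)) {t. badA t (fst xy) \<or> badB t (snd xy)}"
  have "?p \<le> p0"
    using p mult_right_mono[OF card_sum_le[where 'x = 'x and 'y = 'y], of s] s
    unfolding p0_def N_def by linarith
  moreover have "0 \<le> ?p" by (intro sum_nonneg) auto
  ultimately have "(1 - ?p) * log 2 (1 / (1 - p0)) + ?p * log 2 (N / p0) \<le> p0 * (3 + log 2 (N / p0))"
    using p0 N by (intro patch_cost_le) auto
  moreover have "IC_ext_mu \<mu> f 0 \<le> IC_ext_protocol \<mu> P
    + ((1 - ?p) * log 2 (1 / (1 - p0)) + ?p * log 2 (N / p0))"
    unfolding N_def using p0 by (intro IC_ext_mu_patch[OF fin bad]) auto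
  moreover have "N / p0 = 1 / s / 2" using N s by (simp add: p0_def)
  moreover have "log 2 (1 / s / 2) = log 2 (1 / s) - 1" using s by (subst log_divide) auto
  ultimately have "IC_ext_mu \<mu> f 0 \<le> IC_ext_protocol \<mu> P + p0 * (2 + log 2 (1 / s))" by simp
  then show ?thesis unfolding p0_def N_def .
qed

lemma IC_ext_mu_zero_error_le:
  fixes f :: "'x::finite \<Rightarrow> 'y::finite \<Rightarrow> 'z"
  assumes \<epsilon>: "0 < \<epsilon>" "sqrt \<epsilon> * (4 * real (CARD('x) * CARD('y))) \<le> 1"
  shows "IC_ext_mu \<mu> f 0 \<le> IC_ext_mu \<mu> f \<epsilon> + 4 * real CARD('x) * real CARD('y) * bin_entropy (sqrt \<epsilon>)"
proof -
  define s where "s = sqrt \<epsilon>"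
  define N where "N = real (CARD('x) * CARD('y))"
  have s: "0 < s" "s\<^sup>2 = \<epsilon>" "4 * N * s \<le> 1" using \<epsilon> by (auto simp: s_def N_def mult_ac)
  have "1 \<le> CARD('x) * CARD('y)" by (simp add: Suc_leI)
  then have N: "1 \<le> N" unfolding N_def by linarith
  have "4 * 1 * s \<le> 4 * N * s" using N s by (intro mult_mono) auto
  then have s4: "s \<le> 1 / 4" using s by linarith
  \<comment> \<open>As \<open>s \<le> 1 / 4\<close>, the additive 2 is at most
    \<open>log 2 (1 / s)\<close>; this doubling produces the constant 4 of the theorem.\<close>
  have "2 * N * s * (2 + log 2 (1 / s)) \<le> 2 * N * s * (2 * log 2 (1 / s))"
    using le_log2_inverse[OF s(1) s4] N s by (intro mult_left_mono) auto
  also have "\<dots> = 4 * N * (s * log 2 (1 / s))" by simp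
  also have "\<dots> \<le> 4 * N * bin_entropy s"
    using bin_entropy_ge[of s] s s4 N by (intro mult_left_mono) auto
  finally have cost: "2 * N * s * (2 + log 2 (1 / s)) \<le> 4 * N * bin_entropy s" .
  have "IC_ext_mu \<mu> f 0 - 4 * N * bin_entropy s \<le> IC_ext_mu \<mu> f \<epsilon>"
  proof (rule le_IC_ext_mu)
    fix P :: "('x, 'y, 'z) protocol"
    assume P: "finite_protocol P" "performs P f \<epsilon>"
    have perf: "performs P f (s\<^sup>2)" using P(2) s(2) by simp
    have "IC_ext_mu \<mu> f 0 \<le> IC_ext_protocol \<mu> P + 2 * N * s * (2 + log 2 (1 / s))"
    proof (rule rare_alarms[OF P(1) perf s(1), of \<mu>])
      fix badA badB
      assume bad: "\<And>x y t. out P (fst t) (snd t) \<noteq> f x y \<Longrightarrow> badA t x \<or> badB t y"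
        and rare: "(\<Sum>xy\<in>UNIV. pmf \<mu> xy *
          measure_pmf.prob (transcript P (fst xy) (snd xy)) {t. badA t (fst xy) \<or> badB t (snd xy)})
          \<le> (real CARD('x) + real CARD('y)) * s"
      show ?thesis
        unfolding N_def
        by (rule IC_ext_mu_patch_small[where badA = badA and badB = badB, OF P(1) bad s(1) s(3)[unfolded N_def] rare])
    qed
    then show "IC_ext_mu \<mu> f 0 - 4 * N * bin_entropy s \<le> IC_ext_protocol \<mu> P" using cost by linarith
  qed (use \<epsilon> in simp)
  then show ?thesis unfolding s_def N_def by simp
qed

section \<open>Bounds on the information complexity\<close>

lemma bdd_above_IC_ext_mu:
  fixes f :: "'x::finite \<Rightarrow> 'y::finite \<Rightarrow> 'z"
  shows "0 \<le> \<eta> \<Longrightarrow> bdd_above ((\<lambda>\<mu>. IC_ext_mu \<mu> f \<eta>) ` M)"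
  by (rule bdd_aboveI2) (rule IC_ext_mu_bounded)

text \<open>The patching bound is the same for every distribution, so it passes to the supremum over
  any family: later all distributions, and the products.\<close>

lemma SUP_IC_ext_mu_zero_error_le:
  fixes f :: "'x::finite \<Rightarrow> 'y::finite \<Rightarrow> 'z"
  assumes M: "M \<noteq> {}" and \<epsilon>: "0 < \<epsilon>" "\<epsilon> \<le> 1 / (4 * real (CARD('x) * CARD('y)))\<^sup>2"
  shows "(SUP \<mu>\<in>M. IC_ext_mu \<mu> f 0) - (SUP \<mu>\<in>M. IC_ext_mu \<mu> f \<epsilon>)
    \<le> 4 * real CARD('x) * real CARD('y) * bin_entropy (sqrt \<epsilon>)"
proof -
  define N where "N = real (CARD('x) * CARD('y))"
  have N: "0 < 4 * N" unfolding N_def by simp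
  have "sqrt \<epsilon> \<le> sqrt ((1 / (4 * N))\<^sup>2)"
    using \<epsilon> unfolding N_def by (intro real_sqrt_le_mono) (simp add: power_divide)
  then have "sqrt \<epsilon> \<le> 1 / (4 * N)" using N by simp
  then have s: "sqrt \<epsilon> * (4 * real (CARD('x) * CARD('y))) \<le> 1"
    using N unfolding N_def by (simp only: pos_le_divide_eq)
  have "(SUP \<mu>\<in>M. IC_ext_mu \<mu> f 0)
      \<le> (SUP \<mu>\<in>M. IC_ext_mu \<mu> f \<epsilon>) + 4 * real CARD('x) * real CARD('y) * bin_entropy (sqrt \<epsilon>)"
  proof (rule cSUP_least[OF M])
    fix \<mu> assume "\<mu> \<in> M"
    then have "IC_ext_mu \<mu> f \<epsilon> \<le> (SUP \<mu>\<in>M. IC_ext_mu \<mu> f \<epsilon>)"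
      using \<epsilon> by (intro cSUP_upper bdd_above_IC_ext_mu) auto
    then show "IC_ext_mu \<mu> f 0 \<le> (SUP \<mu>\<in>M. IC_ext_mu \<mu> f \<epsilon>)
        + 4 * real CARD('x) * real CARD('y) * bin_entropy (sqrt \<epsilon>)"
      using IC_ext_mu_zero_error_le[OF \<epsilon>(1) s, of \<mu> f] by linarith
  qed
  then show ?thesis by linarith
qed

lemma IC_ext_error_le:
  fixes f :: "'x::finite \<Rightarrow> 'y::finite \<Rightarrow> 'z"
  assumes \<epsilon>: "0 \<le> \<epsilon>" "\<epsilon> < 1"
  shows "IC_ext f \<epsilon> \<le> (1 - \<epsilon>) * IC_ext f 0"
  unfolding IC_ext_def
proof (rule cSUP_least)
  fix \<mu> :: "('x \<times> 'y) pmf"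
  have "IC_ext_mu \<mu> f \<epsilon> \<le> (1 - \<epsilon>) * IC_ext_mu \<mu> f 0" by (rule IC_ext_mu_error_le[OF \<epsilon>])
  also have "\<dots> \<le> (1 - \<epsilon>) * (SUP \<mu>. IC_ext_mu \<mu> f 0)"
    using \<epsilon> by (intro mult_left_mono cSUP_upper bdd_above_IC_ext_mu) auto
  finally show "IC_ext_mu \<mu> f \<epsilon> \<le> (1 - \<epsilon>) * (SUP \<mu>. IC_ext_mu \<mu> f 0)" .
qed simp

section \<open>The entropy gain for product distributions\<close>

lemma ex_adjacent_difference:
  assumes "\<nexists>z. \<forall>x\<in>A. \<forall>y\<in>B. f x y = z"
  obtains x x' y y' where "x \<in> A" "x' \<in> A" "y \<in> B" "y' \<in> B" "x = x' \<or> y = y'" "f x y \<noteq> f x' y'"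
proof -
  obtain x0 y0 where 0: "x0 \<in> A" "y0 \<in> B" using assms by blast
  then obtain x1 y1 where 1: "x1 \<in> A" "y1 \<in> B" "f x1 y1 \<noteq> f x0 y0" using assms by metis
  show ?thesis
  \<comment> \<open>The corner \<open>(x1, y0)\<close> shares a coordinate with both points, and its
    value differs from one of theirs.\<close>
  proof (cases "f x1 y0 = f x0 y0")
    case True
    then show ?thesis using 0 1 that[of x1 x1 y1 y0] by simp
  next
    case False
    then show ?thesis using 0 1 that[of x1 x0 y0 y0] by simp
  qed
qed

text \<open>The protocol outputs \<open>z\<close> without communication, and each player raises an
  alarm if the own input is light. Light values of a coordinate have total mass at most its
  cardinality times \<open>\<delta>\<close>, so the patching bound applies with
  \<open>s = \<delta>\<close>.\<close>

lemma IC_ext_mu_heavy_constant: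
  fixes f :: "'x::finite \<Rightarrow> 'y::finite \<Rightarrow> 'z"
  assumes \<delta>: "0 < \<delta>" "4 * real (CARD('x) * CARD('y)) * \<delta> \<le> 1"
    and const: "\<And>x y. \<delta> \<le> pmf \<mu>1 x \<Longrightarrow> \<delta> \<le> pmf \<mu>2 y \<Longrightarrow> f x y = z"
  shows "IC_ext_mu (pair_pmf \<mu>1 \<mu>2) f 0 \<le> 2 * real (CARD('x) * CARD('y)) * \<delta> * (2 + log 2 (1 / \<delta>))"
proof -
  define P :: "('x, 'y, 'z) protocol" where "P = const_protocol z"
  define badA where "badA t x \<longleftrightarrow> pmf \<mu>1 x < \<delta>" for t :: "nat \<times> bool list" and x
  define badB where "badB t y \<longleftrightarrow> pmf \<mu>2 y < \<delta>" for t :: "nat \<times> bool list" and y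
  have light: "(\<Sum>x\<in>UNIV. pmf \<nu> x * of_bool (pmf \<nu> x < \<delta>)) \<le> real CARD('a) * \<delta>" for \<nu> :: "'a::finite pmf"
    using \<delta> by (intro sum_bounded_above[of UNIV, simplified]) (auto simp: of_bool_def)
  have "(\<Sum>xy\<in>UNIV. pmf (pair_pmf \<mu>1 \<mu>2) xy *
      measure_pmf.prob (transcript P (fst xy) (snd xy)) {t. badA t (fst xy) \<or> badB t (snd xy)})
    = (\<Sum>x\<in>UNIV. \<Sum>y\<in>UNIV. pmf \<mu>1 x * pmf \<mu>2 y * of_bool (pmf \<mu>1 x < \<delta> \<or> pmf \<mu>2 y < \<delta>))"
    unfolding UNIV_Times_UNIV[symmetric] sum.cartesian_product
    by (intro sum.cong refl) (auto simp: pmf_pair P_def const_protocol badA_def badB_def)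
  also have "\<dots> \<le> (\<Sum>x\<in>UNIV. \<Sum>y\<in>UNIV. (pmf \<mu>1 x * of_bool (pmf \<mu>1 x < \<delta>)) * pmf \<mu>2 y
      + pmf \<mu>1 x * (pmf \<mu>2 y * of_bool (pmf \<mu>2 y < \<delta>)))"
    by (intro sum_mono) (auto simp: of_bool_def)
  also have "\<dots> = (\<Sum>x\<in>UNIV. pmf \<mu>1 x * of_bool (pmf \<mu>1 x < \<delta>)) * (\<Sum>y\<in>UNIV. pmf \<mu>2 y)
      + (\<Sum>x\<in>UNIV. pmf \<mu>1 x) * (\<Sum>y\<in>UNIV. pmf \<mu>2 y * of_bool (pmf \<mu>2 y < \<delta>))"
    unfolding sum_product sum.distrib ..
  also have "\<dots> \<le> (real CARD('x) + real CARD('y)) * \<delta>"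
    using light[of \<mu>1] light[of \<mu>2] by (simp add: sum_pmf_eq_1 distrib_right)
  finally have rare: "(\<Sum>xy\<in>UNIV. pmf (pair_pmf \<mu>1 \<mu>2) xy *
      measure_pmf.prob (transcript P (fst xy) (snd xy)) {t. badA t (fst xy) \<or> badB t (snd xy)})
      \<le> (real CARD('x) + real CARD('y)) * \<delta>" .
  have bad: "badA t x \<or> badB t y" if "t \<in> set_pmf (transcript P x y)" "out P (fst t) (snd t) \<noteq> f x y" for t x y
    using that const[of x y] by (cases "pmf \<mu>1 x < \<delta>"; cases "pmf \<mu>2 y < \<delta>") (auto simp: P_def const_protocol badA_def badB_def)
  have "finite_protocol P" unfolding P_def by (rule const_protocol)
  from IC_ext_mu_patch_small[where badA = badA and badB = badB, OF this bad \<delta> rare]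
  show ?thesis by (simp add: P_def IC_ext_const_protocol)
qed

lemma IC_ext_nonpos_of_constant:
  fixes f :: "'x::finite \<Rightarrow> 'y::finite \<Rightarrow> 'z"
  assumes "\<And>x y. f x y = z"
  shows "IC_ext f 0 \<le> 0"
  unfolding IC_ext_def
proof (rule cSUP_least)
  fix \<mu> :: "('x \<times> 'y) pmf"
  have "performs (const_protocol z :: ('x, 'y, 'z) protocol) f 0"
    unfolding performs_def using assms by (simp add: const_protocol measure_return)
  then have "IC_ext_mu \<mu> f 0 \<le> IC_ext_protocol \<mu> (const_protocol z :: ('x, 'y, 'z) protocol)"
    by (rule IC_ext_mu_le[OF const_protocol(1)])
  then show "IC_ext_mu \<mu> f 0 \<le> 0" by (simp add: IC_ext_const_protocol)
qed simp

lemma IC_ext_p_gain: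
  fixes f :: "'x::finite \<Rightarrow> 'y::finite \<Rightarrow> 'z"
  assumes nonconst: "\<nexists>z. \<forall>x y. f x y = z"
  shows "\<exists>c>0. \<forall>\<epsilon>. 0 < \<epsilon> \<and> \<epsilon> \<le> 1 / 4 \<longrightarrow>
    c * bin_entropy \<epsilon> \<le> IC_ext_p f 0 - IC_ext_p f \<epsilon>"
proof -
  define N where "N = real (CARD('x) * CARD('y))"
  have "1 \<le> CARD('x) * CARD('y)" by (simp add: Suc_leI)
  then have N: "1 \<le> N" unfolding N_def by linarith
  define M :: "('x \<times> 'y) pmf set" where "M = {pair_pmf \<mu>1 \<mu>2 | \<mu>1 \<mu>2. True}"
  have M: "M \<noteq> {}" unfolding M_def by blast
  define V where "V = IC_ext_p f 0"
  have V_upper: "IC_ext_mu (pair_pmf \<mu>1 \<mu>2) f 0 \<le> V" for \<mu>1 \<mu>2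
    unfolding V_def IC_ext_p_def by (intro cSUP_upper bdd_above_IC_ext_mu) auto
  \<comment> \<open>Under uniform inputs every value has weight at least \<open>1 / N\<close>, so
    the gain at error \<open>1/4\<close> already forces a positive zero-error cost.\<close>
  have V: "0 < V"
  proof -
    have "\<nexists>z. \<forall>x\<in>UNIV. \<forall>y\<in>UNIV. f x y = z" using nonconst by simp
    then obtain x x' y y' where "x \<in> UNIV" "x' \<in> UNIV" "y \<in> UNIV" "y' \<in> UNIV"
      and adj: "x = x' \<or> y = y'" "f x y \<noteq> f x' y'" by (rule ex_adjacent_difference)
    define \<mu> where "\<mu> = pair_pmf (pmf_of_set (UNIV :: 'x set)) (pmf_of_set (UNIV :: 'y set))"
    have X: "1 / N \<le> 1 / real CARD('x)" and Y: "1 / N \<le> 1 / real CARD('y)"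
      unfolding N_def by (auto simp: field_simps Suc_leI)
    have "IC_ext_mu \<mu> f (1/4) + (1 / N) ^ 3 / 4 * (1/4 * log 2 (1 / (1/4))) \<le> IC_ext_mu \<mu> f 0"
      unfolding \<mu>_def using adj N X Y by (intro IC_ext_mu_product_gain) auto
    moreover have "0 < (1 / N) ^ 3 / 4 * (1/4 * log 2 (1 / (1/4)))" using N by simp
    ultimately have "0 < IC_ext_mu \<mu> f 0" using IC_ext_mu_nonneg[of "1/4" \<mu> f] by linarith
    then show ?thesis using V_upper[of "pmf_of_set UNIV" "pmf_of_set UNIV"] unfolding \<mu>_def by linarith
  qed
  \<comment> \<open>The first bound meets the hypothesis of \<open>IC_ext_mu_heavy_constant\<close>.
    With \<open>\<delta> = u^2\<close> the cost there is at most \<open>10 * N * u\<close>, which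
    the second bound keeps below \<open>V / 2\<close>.\<close>
  define u where "u = min (1 / (4 * N)) (V / (20 * N))"
  have u: "0 < u" "4 * N * u \<le> 1" "20 * N * u \<le> V"
  proof -
    show "0 < u" using V N by (simp add: u_def)
    have "u \<le> 1 / (4 * N)" "u \<le> V / (20 * N)" by (simp_all add: u_def)
    then show "4 * N * u \<le> 1" "20 * N * u \<le> V" using N by (simp_all add: field_simps)
  qed
  have "4 * 1 * u \<le> 4 * N * u" using N u by (intro mult_mono) auto
  then have u1: "u \<le> 1" using u by linarith
  define \<delta> where "\<delta> = u\<^sup>2"
  have \<delta>u: "\<delta> \<le> u" unfolding \<delta>_def power2_eq_square using u u1 by (intro mult_left_le) auto
  have \<delta>: "0 < \<delta>" "4 * N * \<delta> \<le> 1"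
  proof -
    show "0 < \<delta>" using u by (simp add: \<delta>_def)
    have "4 * N * \<delta> \<le> 4 * N * u" using N \<delta>u by (intro mult_left_mono) auto
    then show "4 * N * \<delta> \<le> 1" using u by linarith
  qed
  have small: "2 * N * \<delta> * (2 + log 2 (1 / \<delta>)) \<le> V / 2"
  proof -
    have "\<delta> * log 2 (1 / \<delta>) \<le> \<delta> * (3 / u)"
      unfolding \<delta>_def using u log2_inverse_le[of u] by (intro mult_left_mono) auto
    also have "\<dots> = 3 * u" using u by (simp add: \<delta>_def power2_eq_square)
    finally have "\<delta> * (2 + log 2 (1 / \<delta>)) \<le> 5 * u" using \<delta>u by (simp add: distrib_left)
    then have "2 * N * (\<delta> * (2 + log 2 (1 / \<delta>))) \<le> 2 * N * (5 * u)"
      using N by (intro mult_left_mono) auto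
    then show ?thesis using u(3) by simp
  qed
  \<comment> \<open>Where the zero-error cost is at most \<open>V / 2\<close>, the value
    \<open>V / 6\<close> suffices since \<open>2 * L \<le> 3\<close>. In the other case
    \<open>\<delta> ^ 3 / 8\<close> absorbs the factor 2 between
    \<open>bin_entropy \<epsilon>\<close> and \<open>L\<close>.\<close>
  define c where "c = min (V / 6) (\<delta> ^ 3 / 8)"
  have c: "0 < c" using V \<delta> by (simp add: c_def)
  have "c * bin_entropy \<epsilon> \<le> IC_ext_p f 0 - IC_ext_p f \<epsilon>" if \<epsilon>: "0 < \<epsilon>" "\<epsilon> \<le> 1 / 4" for \<epsilon>
  proof -
    define L where "L = \<epsilon> * log 2 (1 / \<epsilon>)"
    have h: "bin_entropy \<epsilon> \<le> 2 * L" unfolding L_def by (rule bin_entropy_le[OF \<epsilon>])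
    have L0: "0 \<le> L" using \<epsilon> by (simp add: L_def)
    have L: "2 * L \<le> 3"
    proof -
      have sq: "(sqrt \<epsilon>)\<^sup>2 = \<epsilon>" using \<epsilon> by simp
      have "L \<le> \<epsilon> * (3 / sqrt \<epsilon>)"
        unfolding L_def using log2_inverse_le[of "sqrt \<epsilon>"] \<epsilon> sq by (intro mult_left_mono) auto
      also have "\<dots> = 3 * (\<epsilon> / sqrt \<epsilon>)" by simp
      also have "\<dots> = 3 * sqrt \<epsilon>" using \<epsilon> by (simp only: real_div_sqrt less_imp_le)
      also have "\<dots> \<le> 3 * sqrt (1 / 4)" using \<epsilon> by (intro mult_left_mono real_sqrt_le_mono) auto
      also have "sqrt (1 / 4) = 1 / 2" by (simp add: real_sqrt_divide)
      finally show ?thesis by simp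
    qed
    have "IC_ext_p f \<epsilon> \<le> V - c * (2 * L)"
      unfolding IC_ext_p_def M_def[symmetric]
    proof (rule cSUP_least[OF M])
      fix \<mu> assume "\<mu> \<in> M"
      then obtain \<mu>1 \<mu>2 where \<mu>: "\<mu> = pair_pmf \<mu>1 \<mu>2" unfolding M_def by blast
      show "IC_ext_mu \<mu> f \<epsilon> \<le> V - c * (2 * L)"
      proof (cases "\<exists>z. \<forall>x\<in>{x. \<delta> \<le> pmf \<mu>1 x}. \<forall>y\<in>{y. \<delta> \<le> pmf \<mu>2 y}. f x y = z")
        case True
        then obtain z where z: "\<And>x y. \<delta> \<le> pmf \<mu>1 x \<Longrightarrow> \<delta> \<le> pmf \<mu>2 y \<Longrightarrow> f x y = z" by auto
        have "IC_ext_mu \<mu> f \<epsilon> \<le> IC_ext_mu \<mu> f 0" using \<epsilon> by (intro IC_ext_mu_antimono) auto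
        also have "\<dots> \<le> 2 * N * \<delta> * (2 + log 2 (1 / \<delta>))"
          unfolding \<mu> N_def using \<delta> z unfolding N_def by (rule IC_ext_mu_heavy_constant)
        also have "\<dots> \<le> V / 2" by (rule small)
        finally have "IC_ext_mu \<mu> f \<epsilon> \<le> V / 2" .
        moreover have "c * (2 * L) \<le> V / 6 * 3"
          using L L0 c V by (intro mult_mono) (auto simp: c_def)
        ultimately show ?thesis by linarith
      next
        case False
        obtain x x' y y' where "x \<in> {x. \<delta> \<le> pmf \<mu>1 x}" "x' \<in> {x. \<delta> \<le> pmf \<mu>1 x}"
          "y \<in> {y. \<delta> \<le> pmf \<mu>2 y}" "y' \<in> {y. \<delta> \<le> pmf \<mu>2 y}" "x = x' \<or> y = y'" "f x y \<noteq> f x' y'"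
          by (rule ex_adjacent_difference[OF False])
        then have "IC_ext_mu \<mu> f \<epsilon> + \<delta> ^ 3 / 4 * L \<le> IC_ext_mu \<mu> f 0"
          unfolding \<mu> L_def using \<epsilon> \<delta> by (intro IC_ext_mu_product_gain[of _ _ _ x x' _ y y']) auto
        moreover have "IC_ext_mu \<mu> f 0 \<le> V" unfolding \<mu> by (rule V_upper)
        moreover have "c * (2 * L) \<le> \<delta> ^ 3 / 8 * (2 * L)"
          using L0 by (intro mult_right_mono) (auto simp: c_def)
        moreover have "\<delta> ^ 3 / 8 * (2 * L) = \<delta> ^ 3 / 4 * L" by simp
        ultimately show ?thesis by linarith
      qed
    qed
    moreover have "c * bin_entropy \<epsilon> \<le> c * (2 * L)" using h c by (intro mult_left_mono) auto
    ultimately show ?thesis unfolding V_def by linarith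
  qed
  with c show ?thesis by (intro exI[of _ c] conjI allI impI) simp_all
qed

theorem theorem3:
  fixes f :: "'x::finite \<Rightarrow> 'y::finite \<Rightarrow> 'z::finite"
  assumes "IC_ext f 0 > 0"
  shows "(\<exists>\<epsilon>0>0. \<forall>\<epsilon>. 0 < \<epsilon> \<and> \<epsilon> \<le> \<epsilon>0 \<longrightarrow>
            \<epsilon> * IC_ext f 0 / 2 \<le> IC_ext f 0 - IC_ext f \<epsilon> \<and>
            IC_ext f 0 - IC_ext f \<epsilon> \<le> 4 * real CARD('x) * real CARD('y) * bin_entropy (sqrt \<epsilon>))
       \<and> (\<exists>\<epsilon>1>0. \<exists>c>0. \<forall>\<epsilon>. 0 < \<epsilon> \<and> \<epsilon> \<le> \<epsilon>1 \<longrightarrow>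
            c * bin_entropy \<epsilon> \<le> IC_ext_p f 0 - IC_ext_p f \<epsilon> \<and>
            IC_ext_p f 0 - IC_ext_p f \<epsilon> \<le> 4 * real CARD('x) * real CARD('y) * bin_entropy (sqrt \<epsilon>))"
proof -
  \<comment> \<open>\<open>1 / 4\<close> is the range of \<open>IC_ext_p_gain\<close>; the other
    bound gives \<open>4 * N * sqrt \<epsilon> \<le> 1\<close> for
    \<open>N = CARD('x) * CARD('y)\<close>, as patching requires.\<close>
  define e where "e = min (1 / 4) (1 / (4 * real (CARD('x) * CARD('y)))\<^sup>2)"
  have e: "0 < e" "e \<le> 1 / 4" "e \<le> 1 / (4 * real (CARD('x) * CARD('y)))\<^sup>2"
    unfolding e_def min_less_iff_conj by (simp, rule min.cobounded1, rule min.cobounded2)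
  have "\<nexists>z. \<forall>x y. f x y = z"
  proof
    assume "\<exists>z. \<forall>x y. f x y = z"
    then obtain z where "\<And>x y. f x y = z" by blast
    from IC_ext_nonpos_of_constant[of f z, OF this] show False using assms by linarith
  qed
  from IC_ext_p_gain[OF this] obtain c where c: "0 < c"
    "\<forall>\<epsilon>. 0 < \<epsilon> \<and> \<epsilon> \<le> 1 / 4 \<longrightarrow> c * bin_entropy \<epsilon> \<le> IC_ext_p f 0 - IC_ext_p f \<epsilon>"
    by blast
  have bound: "\<epsilon> \<le> 1 / (4 * real (CARD('x) * CARD('y)))\<^sup>2" "\<epsilon> \<le> 1 / 4" "\<epsilon> < 1"
    if "\<epsilon> \<le> e" for \<epsilon>
    using that e by linarith+
  have upper: "IC_ext f 0 - IC_ext f \<epsilon> \<le> 4 * real CARD('x) * real CARD('y) * bin_entropy (sqrt \<epsilon>)"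
    and upper_p: "IC_ext_p f 0 - IC_ext_p f \<epsilon> \<le> 4 * real CARD('x) * real CARD('y) * bin_entropy (sqrt \<epsilon>)"
    if "0 < \<epsilon>" "\<epsilon> \<le> e" for \<epsilon>
    unfolding IC_ext_def IC_ext_p_def
    by (rule SUP_IC_ext_mu_zero_error_le[OF _ that(1) bound(1)[OF that(2)]], blast)+
  \<comment> \<open>Halting saves the full \<open>\<epsilon> * IC_ext f 0\<close>; since this is
    nonnegative, the stated half follows.\<close>
  have lower: "\<epsilon> * IC_ext f 0 / 2 \<le> IC_ext f 0 - IC_ext f \<epsilon>" if "0 < \<epsilon>" "\<epsilon> \<le> e" for \<epsilon>
  proof -
    have "IC_ext f \<epsilon> \<le> (1 - \<epsilon>) * IC_ext f 0"
      using that(1) bound(3)[OF that(2)] by (intro IC_ext_error_le) simp_all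
    moreover have "0 \<le> \<epsilon> * IC_ext f 0" using that assms by simp
    ultimately show ?thesis by (simp add: left_diff_distrib)
  qed
  have "\<forall>\<epsilon>. 0 < \<epsilon> \<and> \<epsilon> \<le> e \<longrightarrow>
      \<epsilon> * IC_ext f 0 / 2 \<le> IC_ext f 0 - IC_ext f \<epsilon> \<and>
      IC_ext f 0 - IC_ext f \<epsilon> \<le> 4 * real CARD('x) * real CARD('y) * bin_entropy (sqrt \<epsilon>)"
    using lower upper by blast
  moreover have "\<forall>\<epsilon>. 0 < \<epsilon> \<and> \<epsilon> \<le> e \<longrightarrow>
      c * bin_entropy \<epsilon> \<le> IC_ext_p f 0 - IC_ext_p f \<epsilon> \<and>
      IC_ext_p f 0 - IC_ext_p f \<epsilon> \<le> 4 * real CARD('x) * real CARD('y) * bin_entropy (sqrt \<epsilon>)"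
    using c(2) bound(2) upper_p by blast
  ultimately show ?thesis using e(1) c(1) by blast
qed

end
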